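(* Let $\varphi$ be a Boolean formula, $S \subseteq Supp(\varphi)$, $\mathtt{wt}$ a weight function on assignments to $S$, $\mathcal{G}$ a sampler and $\mathcal{A}$ the ideal sampler with respect to $\mathtt{wt}$. Let $\varepsilon < \frac{1}{3}$, $\eta > 6\varepsilon$ and $\delta \in (0,1)$. Then $\mathsf{Barbarik2}(\mathcal{G},\mathcal{A},\varepsilon,\eta,\delta,\varphi,S,\mathtt{wt})$ draws at most $\widetilde{O}\left(\frac{tilt(\mathtt{wt},\varphi)^2}{\eta(\eta-6\varepsilon)^3}\right)$ samples in total, where $\widetilde{O}$ hides a polylogarithmic factor in $1/\delta$. Moreover: (1) if $\mathcal{G}$ is $\varepsilon$-close to $\mathcal{A}$, then $\mathsf{Barbarik2}$ returns ACCEPT with probability at least $1-\delta$; (2) if $\mathcal{G}$ is subquery consistent with respect to $\mathsf{Barbarik2Kernel}$ for $\varphi$ and $\mathcal{D}_{\mathcal{G}(\varphi)}$ is $\eta$-far from the ideal sampler, then $\mathsf{Barbarik2}$ returns REJECT with probability at least $1-\delta$.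
   Context: For a Boolean formula $\varphi$, $Supp(\varphi)$ is its set of variables, $R_\varphi$ its set of satisfying assignments, and for $S \subseteq Supp(\varphi)$, $R_{\varphi_{\downarrow S}} = \{\sigma_{\downarrow S} : \sigma \in R_\varphi\}$ where $\sigma_{\downarrow S}$ is the projection of $\sigma$ onto $S$. A weight function is a map $\mathtt{wt}:\{0,1\}^{|S|}\to(0,1)$. A sampler $\mathcal{G}(\varphi,S,\mathtt{wt},\tau)$ is a randomized algorithm outputting $\tau$ independent samples from $R_{\varphi_{\downarrow S}}$; $p_{\mathcal{G}}(\varphi,S,\sigma)$ denotes the probability it outputs $\sigma$, and $\mathcal{D}_{\mathcal{G}(\varphi)}$ is the induced distribution on $R_{\varphi_{\downarrow S}}$. The ideal sampler $\mathcal{A}$ satisfies $p_{\mathcal{A}}(\varphi,S,\sigma) = \mathtt{wt}(\sigma)/\sum_{\sigma' \in R_{\varphi_{\downarrow S}}}\mathtt{wt}(\sigma')$ for all $\sigma \in R_{\varphi_{\downarrow S}}$ (and likewise for any formula in place of $\varphi$). $tilt(\mathtt{wt},\varphi) = \max_{\sigma_1,\sigma_2 \in R_{\varphi_{\downarrow S}}} \mathtt{wt}(\sigma_1)/\mathtt{wt}(\sigma_2)$. $\mathcal{G}$ is $\varepsilon$-close to $\mathcal{A}$ if for all formulas $\varphi$ and all satisfying $\sigma$, $(1-\varepsilon)p_{\mathcal{A}}(\varphi,\sigma) \le p_{\mathcal{G}}(\varphi,\sigma) \le (1+\varepsilon)p_{\mathcal{A}}(\varphi,\sigma)$. $\mathcal{G}(\varphi)$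 is $\eta$-far from $\mathcal{A}(\varphi)$ if $\sum_{\sigma}|p_{\mathcal{A}}(\varphi,\sigma)-p_{\mathcal{G}}(\varphi,\sigma)| \ge \eta$. $\mathsf{Barbarik2Kernel}(\varphi,\sigma_1,\sigma_2)$ (for $\sigma_1\neq\sigma_2 \in R_{\varphi_{\downarrow S}}$, viewed as sets of literals): set $m=12$, $k=2^m-1$; let $\mathrm{Lits}_1$ be the literals in $\sigma_1$ not in $\sigma_2$ and $\mathrm{Lits}_2$ those in $\sigma_2$ not in $\sigma_1$; let $V$ be $m$ fresh variables and $\psi_{k,m}(V)$ a formula over $V$ with exactly $k$ satisfying assignments (a chain formula); set $\hat\varphi = \varphi \wedge (\sigma_1 \vee \sigma_2)$ (each $\sigma_i$ read as the conjunction of its literals); choose a literal $l$ uniformly at random from $\mathrm{Lits}_1\cup\mathrm{Lits}_2$; return $\hat\varphi \wedge (\neg l \to \psi_{k,m}(V)) \wedge (l \to \psi_{k,m}(V))$. Thus the only assignments to $S$ extendable to satisfying assignments of the output are $\sigma_1,\sigma_2$. $\mathcal{G}$ is subquery consistent w.r.t. $\mathsf{Barbarik2Kernel}$ for $\varphi$ if for all $S\subseteq Supp(\varphi)$ and $\sigma_1,\sigma_2\in R_{\varphi_{\downarrow S}}$, with $\hat\varphi$ the kernel output, $\mathcal{G}(\hat\varphi,\mathtt{wt},S,\tau)$ outputs $\tau$ independent samples from the conditional distribution of $\mathcal{D}_{\mathcal{G}(\varphi)}$ on $\{\sigma_1,\sigma_2\}$. $\mathsf{Barbarik2}(\mathcal{G},\mathcal{A},\varepsilon,\eta,\delta,\varphi,S,\mathtt{wt})$: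 set $t = \ln(1/\delta)\big/\ln\!\left(\frac{10}{10-\eta(\eta-6\varepsilon)}\right)$, $n = 8\ln(t/\delta)$, $lo = (1+\varepsilon)/(1-\varepsilon)$, $hi = 1+(\eta+6\varepsilon)/4$. Draw a list $\Gamma_1$ of $t$ samples from $\mathcal{G}(\varphi,S)$ and a list $\Gamma_2$ of $t$ samples from $\mathcal{A}(\varphi,S)$. For $i=1,\dots,t$: let $\sigma_1=\Gamma_1[i]$, $\sigma_2=\Gamma_2[i]$; if $\sigma_1=\sigma_2$ go to the next $i$; else set $\alpha=\mathtt{wt}(\sigma_1)/\mathtt{wt}(\sigma_2)$, $L = \alpha\, lo/(1+\alpha\, lo)$, $H=\alpha\, hi/(1+\alpha\, hi)$, $T=(H+L)/2$, $N = nH/(H-L)^2$; compute $\hat\varphi=\mathsf{Barbarik2Kernel}(\varphi,\sigma_1,\sigma_2)$; draw a list $\Gamma_3$ of $N$ samples from $\mathcal{G}(\hat\varphi,S)$; let $Bias$ be the fraction of elements of $\Gamma_3$ whose projection on $S$ equals $\sigma_1$; if $Bias > T$ return REJECT. After the loop return ACCEPT.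
   Formalization: The sample bound gets an extra factor 1+ln(1+1/(η(η-6ε))), dropped when δ ≤ η(η-6ε), and hides powers of 1+ln(1/δ), since hiding only polylog(1/δ) is false as η→0 with δ fixed; also assumed: φ satisfiable, ε ≥ 0, η(η-6ε)<10 (so t is defined); t and N are rounded up. *)

theory Defs
  imports "HOL-Probability.Probability"
begin

subsection \<open>Boolean formulas\<close>

datatype formula =
    Bot
  | Var nat
  | Neg formula
  | And formula formula
  | Or formula formula
  | Imp formula formula

text \<open>
  An assignment to a set of variables is a partial map whose domain is that set; its set of literals
  is \<open>Map.graph \<sigma>\<close>, and its projection onto \<open>S\<close> is \<open>\<sigma> |` S\<close>.
\<close>

type_synonym assignment = "nat \<rightharpoonup> bool"

primrec Supp :: "formula \<Rightarrow> nat set" where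
  "Supp Bot = {}"
| "Supp (Var v) = {v}"
| "Supp (Neg f) = Supp f"
| "Supp (And f g) = Supp f \<union> Supp g"
| "Supp (Or f g) = Supp f \<union> Supp g"
| "Supp (Imp f g) = Supp f \<union> Supp g"

primrec sat :: "assignment \<Rightarrow> formula \<Rightarrow> bool" where
  "sat \<sigma> Bot \<longleftrightarrow> False"
| "sat \<sigma> (Var v) \<longleftrightarrow> \<sigma> v = Some True"
| "sat \<sigma> (Neg f) \<longleftrightarrow> \<not> sat \<sigma> f"
| "sat \<sigma> (And f g) \<longleftrightarrow> sat \<sigma> f \<and> sat \<sigma> g"
| "sat \<sigma> (Or f g) \<longleftrightarrow> sat \<sigma> f \<or> sat \<sigma> g"
| "sat \<sigma> (Imp f g) \<longleftrightarrow> (sat \<sigma> f \<longrightarrow> sat \<sigma> g)"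

definition models :: "formula \<Rightarrow> assignment set" where
  "models \<phi> = {\<sigma>. dom \<sigma> = Supp \<phi> \<and> sat \<sigma> \<phi>}"

definition proj_models :: "formula \<Rightarrow> nat set \<Rightarrow> assignment set" where
  "proj_models \<phi> S = (\<lambda>\<sigma>. \<sigma> |` S) ` models \<phi>"

fun lit_formula :: "nat \<times> bool \<Rightarrow> formula" where
  "lit_formula (v, b) = (if b then Var v else Neg (Var v))"

definition conj_lits :: "assignment \<Rightarrow> formula" where
  "conj_lits \<sigma> =
     foldr (\<lambda>v. And (lit_formula (v, the (\<sigma> v)))) (sorted_list_of_set (dom \<sigma>)) (Neg Bot)"


subsection \<open>Samplers\<close>

type_synonym weight = "assignment \<Rightarrow> real"

definition weight_function :: "nat set \<Rightarrow> weight \<Rightarrow> bool" where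
  "weight_function S wt \<longleftrightarrow> (\<forall>\<sigma>. dom \<sigma> = S \<longrightarrow> 0 < wt \<sigma> \<and> wt \<sigma> < 1)"

text \<open>
  The samples returned by a sampler are independent, so a sampler is given by the distribution of a
  single sample, and \<open>\<tau>\<close> samples are drawn from \<open>replicate_pmf \<tau> (G \<phi> S wt)\<close>. The probability
  of the output \<open>\<sigma>\<close> is \<open>pmf (G \<phi> S wt) \<sigma>\<close>. Nothing is required on unsatisfiable formulas, which
  have no possible output.
\<close>

type_synonym sampler = "formula \<Rightarrow> nat set \<Rightarrow> weight \<Rightarrow> assignment pmf"

definition is_sampler :: "sampler \<Rightarrow> bool" where
  "is_sampler G \<longleftrightarrow>
     (\<forall>\<phi> S wt. models \<phi> \<noteq> {} \<and> S \<subseteq> Supp \<phi> \<and> weight_function S wt \<longrightarrow>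
        set_pmf (G \<phi> S wt) \<subseteq> proj_models \<phi> S)"

definition ideal_sampler :: "nat set \<Rightarrow> weight \<Rightarrow> sampler \<Rightarrow> bool" where
  "ideal_sampler S wt A \<longleftrightarrow> is_sampler A \<and>
     (\<forall>\<phi>. S \<subseteq> Supp \<phi> \<longrightarrow>
        (\<forall>\<sigma>\<in>proj_models \<phi> S.
           pmf (A \<phi> S wt) \<sigma> = wt \<sigma> / (\<Sum>\<sigma>'\<in>proj_models \<phi> S. wt \<sigma>')))"

definition tilt :: "weight \<Rightarrow> formula \<Rightarrow> nat set \<Rightarrow> real" where
  "tilt wt \<phi> S =
     Max {wt \<sigma>1 / wt \<sigma>2 |\<sigma>1 \<sigma>2. \<sigma>1 \<in> proj_models \<phi> S \<and> \<sigma>2 \<in> proj_models \<phi> S}"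

definition eps_close :: "real \<Rightarrow> nat set \<Rightarrow> weight \<Rightarrow> sampler \<Rightarrow> sampler \<Rightarrow> bool" where
  "eps_close \<epsilon> S wt G A \<longleftrightarrow>
     (\<forall>\<phi>. S \<subseteq> Supp \<phi> \<longrightarrow>
        (\<forall>\<sigma>\<in>proj_models \<phi> S.
           (1 - \<epsilon>) * pmf (A \<phi> S wt) \<sigma> \<le> pmf (G \<phi> S wt) \<sigma> \<and>
           pmf (G \<phi> S wt) \<sigma> \<le> (1 + \<epsilon>) * pmf (A \<phi> S wt) \<sigma>))"

definition eta_far :: "real \<Rightarrow> formula \<Rightarrow> nat set \<Rightarrow> weight \<Rightarrow> sampler \<Rightarrow> sampler \<Rightarrow> bool" where
  "eta_far \<eta> \<phi> S wt G A \<longleftrightarrow>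
     (\<Sum>\<sigma>\<in>proj_models \<phi> S. \<bar>pmf (A \<phi> S wt) \<sigma> - pmf (G \<phi> S wt) \<sigma>\<bar>) \<ge> \<eta>"


subsection \<open>The kernel\<close>

text \<open>
  For \<open>0 < k < 2 ^ length vs\<close>, \<open>chain_formula k vs\<close> has exactly \<open>k\<close> satisfying assignments to the
  (distinct) variables \<open>vs\<close>: the binary digits of \<open>k\<close>, most significant first, select between
  disjunction and conjunction, and the chain stops at the least significant digit \<open>1\<close>.
\<close>

fun chain_formula :: "nat \<Rightarrow> nat list \<Rightarrow> formula" where
  "chain_formula k [] = Bot"
| "chain_formula k (v # vs) =
     (if k = 2 ^ length vs then Var v
      else if k > 2 ^ length vs then Or (Var v) (chain_formula (k - 2 ^ length vs) vs)
      else And (Var v) (chain_formula k vs))"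

abbreviation kernel_m :: nat where "kernel_m \<equiv> 12"
abbreviation kernel_k :: nat where "kernel_k \<equiv> 2 ^ kernel_m - 1"

definition fresh_vars :: "nat list \<Rightarrow> formula \<Rightarrow> bool" where
  "fresh_vars V \<phi> \<longleftrightarrow> distinct V \<and> length V = kernel_m \<and> set V \<inter> Supp \<phi> = {}"

text \<open>The choice \<open>V\<close> of the fresh variables is an explicit argument.\<close>

definition barbarik2_kernel ::
  "nat list \<Rightarrow> formula \<Rightarrow> assignment \<Rightarrow> assignment \<Rightarrow> formula pmf" where
  "barbarik2_kernel V \<phi> \<sigma>1 \<sigma>2 =
     (let Lits1 = Map.graph \<sigma>1 - Map.graph \<sigma>2;
          Lits2 = Map.graph \<sigma>2 - Map.graph \<sigma>1;
          \<psi> = chain_formula kernel_k V;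
          \<phi>' = And \<phi> (Or (conj_lits \<sigma>1) (conj_lits \<sigma>2))
      in do {
        l \<leftarrow> pmf_of_set (Lits1 \<union> Lits2);
        return_pmf (And (And \<phi>' (Imp (Neg (lit_formula l)) \<psi>)) (Imp (lit_formula l) \<psi>))
      })"

text \<open>
  The conditional distribution on \<open>{\<sigma>1, \<sigma>2}\<close> exists only if this set has positive probability.
  The set \<open>S'\<close> ranges over the sets of variables whose assignments are weighted by \<open>wt\<close>.
\<close>

definition subquery_consistent ::
  "nat list \<Rightarrow> weight \<Rightarrow> formula \<Rightarrow> sampler \<Rightarrow> bool" where
  "subquery_consistent V wt \<phi> G \<longleftrightarrow>
     (\<forall>S' \<sigma>1 \<sigma>2 \<phi>'.
        S' \<subseteq> Supp \<phi> \<and> weight_function S' wt \<and>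
        \<sigma>1 \<in> proj_models \<phi> S' \<and> \<sigma>2 \<in> proj_models \<phi> S' \<and> \<sigma>1 \<noteq> \<sigma>2 \<and>
        set_pmf (G \<phi> S' wt) \<inter> {\<sigma>1, \<sigma>2} \<noteq> {} \<and>
        \<phi>' \<in> set_pmf (barbarik2_kernel V \<phi> \<sigma>1 \<sigma>2) \<longrightarrow>
        G \<phi>' S' wt = cond_pmf (G \<phi> S' wt) {\<sigma>1, \<sigma>2})"


subsection \<open>The tester\<close>

text \<open>The numbers of iterations and of samples are rounded up to integers.\<close>

definition num_iterations :: "real \<Rightarrow> real \<Rightarrow> real \<Rightarrow> nat" where
  "num_iterations \<epsilon> \<eta> \<delta> = nat \<lceil>ln (1 / \<delta>) / ln (10 / (10 - \<eta> * (\<eta> - 6 * \<epsilon>)))\<rceil>"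

definition test_n :: "real \<Rightarrow> real \<Rightarrow> real \<Rightarrow> real" where
  "test_n \<epsilon> \<eta> \<delta> = 8 * ln (real (num_iterations \<epsilon> \<eta> \<delta>) / \<delta>)"

definition test_lo :: "real \<Rightarrow> real" where
  "test_lo \<epsilon> = (1 + \<epsilon>) / (1 - \<epsilon>)"

definition test_hi :: "real \<Rightarrow> real \<Rightarrow> real" where
  "test_hi \<epsilon> \<eta> = 1 + (\<eta> + 6 * \<epsilon>) / 4"

datatype verdict = ACCEPT | REJECT

text \<open>
  The second component of the result is the total number of samples drawn, from \<open>G\<close> and from \<open>A\<close>.
\<close>

primrec barbarik2_loop ::
  "sampler \<Rightarrow> real \<Rightarrow> real \<Rightarrow> real \<Rightarrow> formula \<Rightarrow> nat set \<Rightarrow> weight \<Rightarrow> nat list \<Rightarrow>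
   (assignment \<times> assignment) list \<Rightarrow> nat \<Rightarrow> (verdict \<times> nat) pmf" where
  "barbarik2_loop G \<epsilon> \<eta> \<delta> \<phi> S wt V [] c = return_pmf (ACCEPT, c)"
| "barbarik2_loop G \<epsilon> \<eta> \<delta> \<phi> S wt V (p # ps) c =
     (let \<sigma>1 = fst p; \<sigma>2 = snd p in
      if \<sigma>1 = \<sigma>2 then barbarik2_loop G \<epsilon> \<eta> \<delta> \<phi> S wt V ps c
      else
        let \<alpha> = wt \<sigma>1 / wt \<sigma>2;
            L = \<alpha> * test_lo \<epsilon> / (1 + \<alpha> * test_lo \<epsilon>);
            H = \<alpha> * test_hi \<epsilon> \<eta> / (1 + \<alpha> * test_hi \<epsilon> \<eta>);
            T = (H + L) / 2;
            N = nat \<lceil>test_n \<epsilon> \<eta> \<delta> * H / (H - L)\<^sup>2\<rceil>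
        in do {
          \<phi>' \<leftarrow> barbarik2_kernel V \<phi> \<sigma>1 \<sigma>2;
          \<Gamma>3 \<leftarrow> replicate_pmf N (G \<phi>' S wt);
          let Bias = real (length (filter (\<lambda>\<sigma>. \<sigma> |` S = \<sigma>1) \<Gamma>3)) / real N;
          if Bias > T then return_pmf (REJECT, c + N)
          else barbarik2_loop G \<epsilon> \<eta> \<delta> \<phi> S wt V ps (c + N)
        })"

definition barbarik2 ::
  "sampler \<Rightarrow> sampler \<Rightarrow> real \<Rightarrow> real \<Rightarrow> real \<Rightarrow> formula \<Rightarrow> nat set \<Rightarrow> weight \<Rightarrow> nat list \<Rightarrow>
   (verdict \<times> nat) pmf" where
  "barbarik2 G A \<epsilon> \<eta> \<delta> \<phi> S wt V =
     (let t = num_iterations \<epsilon> \<eta> \<delta> in do {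
        \<Gamma>1 \<leftarrow> replicate_pmf t (G \<phi> S wt);
        \<Gamma>2 \<leftarrow> replicate_pmf t (A \<phi> S wt);
        barbarik2_loop G \<epsilon> \<eta> \<delta> \<phi> S wt V (zip \<Gamma>1 \<Gamma>2) (2 * t)
      })"

end

theory Submission
  imports Defs
begin

text \<open>
  Let \<open>g\<close> and \<open>a\<close> be the distributions of \<open>G\<close> and of the ideal sampler, \<open>\<tau> = \<eta> / 2\<close> and
  \<open>x = \<eta> (\<eta> - 6 \<epsilon>)\<close>. If \<open>G\<close> is \<open>\<epsilon>\<close>-close, then every iteration draws samples that hit \<open>\<sigma>1\<close> with
  probability at most \<open>L\<close>, and by a multiplicative Chernoff bound it rejects with probability at most
  \<open>\<delta> / t\<close>.

  If \<open>G\<close> is \<open>\<eta>\<close>-far, call a pair bad if \<open>g \<sigma>1 / a \<sigma>1\<close> exceeds both \<open>1\<close> and \<open>hi\<close> times \<open>g \<sigma>2 / a \<sigma>2\<close>.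
  Then the hit probability is at least \<open>H\<close>, and a bad pair is drawn with probability at least
  \<open>B = \<tau> (1 - (1 - \<tau>)\<^sup>2 / 4)\<close>. It suffices that an iteration rejects with probability at least \<open>x / 10\<close>. If
  \<open>t \<ge> 2\<close>, a bad pair is rejected with probability at least \<open>1 - \<delta> / t \<ge> 1 / 2\<close>, and \<open>B / 2 \<ge> x / 10\<close>. If
  \<open>t = 1\<close>, the Chernoff bound no longer suffices. There a rejection probability of \<open>1 - \<delta> \<le> x / 10\<close> is enough,
  and the binomial tail is bounded below by Cantelli's inequality (large \<open>\<tau>\<close>) or by a fourth
  moment argument (small \<open>\<tau>\<close>).
\<close>

subsection \<open>Binomial tails\<close>

text \<open>Condition on one Bernoulli trial. Monotonicity in \<open>p\<close>, the moment
  generating function and the moments are all obtained by induction along this recursion.\<close>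

lemma expectation_binomial_Suc:
  fixes f :: "nat \<Rightarrow> real"
  assumes "p \<in> {0..1}"
  shows "measure_pmf.expectation (binomial_pmf (Suc n) p) f =
    p * measure_pmf.expectation (binomial_pmf n p) (\<lambda>k. f (Suc k)) +
    (1 - p) * measure_pmf.expectation (binomial_pmf n p) f"
proof -
  let ?B = "binomial_pmf n p"
  have fin: "finite (set_pmf ?B)"
    using assms by (rule finite_set_pmf_binomial_pmf)
  have "binomial_pmf (Suc n) p =
      bernoulli_pmf p \<bind> (\<lambda>b. map_pmf (\<lambda>k. if b then Suc k else k) ?B)"
    unfolding binomial_pmf_Suc[OF assms] map_pmf_def
    by (intro bind_pmf_cong refl) auto
  moreover have "measure_pmf.expectation
      (bernoulli_pmf p \<bind> (\<lambda>b. map_pmf (\<lambda>k. if b then Suc k else k) ?B)) f =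
    (\<Sum>b\<in>UNIV. pmf (bernoulli_pmf p) b *\<^sub>R
       measure_pmf.expectation (map_pmf (\<lambda>k. if b then Suc k else k) ?B) f)"
    using fin by (intro pmf_expectation_bind) auto
  ultimately show ?thesis
    using assms by (simp add: UNIV_bool)
qed

lemma expectation_binomial_0:
  fixes f :: "nat \<Rightarrow> real"
  assumes "p \<in> {0..1}"
  shows "measure_pmf.expectation (binomial_pmf 0 p) f = f 0"
  using assms by (simp add: binomial_pmf_0)

text \<open>In the recursion, raising \<open>p\<close> to \<open>p'\<close> moves weight
  \<open>p' - p\<close> from \<open>f\<close> to the pointwise larger
  \<open>\<lambda>k. f (Suc k)\<close>. The induction ranges over all monotone \<open>f\<close>
  because its hypothesis is applied to both.\<close>

lemma expectation_binomial_mono: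
  fixes f :: "nat \<Rightarrow> real"
  assumes "0 \<le> p" "p \<le> p'" "p' \<le> 1" "mono f"
  shows "measure_pmf.expectation (binomial_pmf n p) f \<le>
         measure_pmf.expectation (binomial_pmf n p') f"
  using assms(4)
proof (induction n arbitrary: f)
  case 0
  then show ?case using assms by (simp add: expectation_binomial_0)
next
  case (Suc n)
  let ?E = "\<lambda>p. measure_pmf.expectation (binomial_pmf n p)"
  have p: "p \<in> {0..1}" "p' \<in> {0..1}" using assms by auto
  have mono_Suc: "mono (\<lambda>k. f (Suc k))"
    using Suc.prems by (auto simp: mono_def)
  have le: "?E p f \<le> ?E p (\<lambda>k. f (Suc k))"
    using p Suc.prems by (intro integral_mono integrable_binomial_pmf) (auto simp: mono_def)
  have "p * ?E p (\<lambda>k. f (Suc k)) + (1 - p) * ?E p f \<le>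
        p' * ?E p (\<lambda>k. f (Suc k)) + (1 - p') * ?E p f"
    using mult_left_mono[OF le, of "p' - p"] assms by (simp add: algebra_simps)
  also have "\<dots> \<le> p' * ?E p' (\<lambda>k. f (Suc k)) + (1 - p') * ?E p' f"
    using Suc.IH[OF mono_Suc] Suc.IH[OF Suc.prems] assms
    by (intro add_mono mult_left_mono) auto
  finally show ?case
    using p by (simp add: expectation_binomial_Suc)
qed

lemma binomial_upper_tail_mono:
  assumes "0 \<le> p" "p \<le> p'" "p' \<le> 1"
  shows "measure_pmf.prob (binomial_pmf n p) {k. real k > a} \<le>
         measure_pmf.prob (binomial_pmf n p') {k. real k > a}"
proof -
  have "mono (indicator {k. real k > a} :: nat \<Rightarrow> real)"
    by (auto simp: mono_def indicator_def)
  from expectation_binomial_mono[OF assms this, of n] show ?thesis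
    by simp
qed

section \<open>Exponential tail bounds for the binomial distribution\<close>

lemma binomial_mgf:
  assumes "p \<in> {0..1}"
  shows "measure_pmf.expectation (binomial_pmf n p) (\<lambda>k. exp (c * real k)) =
         (1 - p + p * exp c) ^ n"
proof (induction n)
  case 0
  then show ?case using assms by (simp add: expectation_binomial_0)
next
  case (Suc n)
  have "measure_pmf.expectation (binomial_pmf n p) (\<lambda>k. exp (c * real (Suc k))) =
        exp c * (1 - p + p * exp c) ^ n"
    unfolding Suc[symmetric]
    by (subst integral_mult_right_zero[symmetric]) (simp add: algebra_simps exp_add)
  then show ?case
    using assms by (simp add: expectation_binomial_Suc Suc algebra_simps)
qed

text \<open>Exponential Markov inequality: \<open>exp (c * (k - a))\<close> is at least 1 on
  \<open>K\<close>. The sign of \<open>c\<close> is left open, so that \<open>c \<ge> 0\<close>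
  serves upper tails and \<open>c \<le> 0\<close> lower tails; \<open>1 + u \<le> exp u\<close>
  simplifies the generating function.\<close>

lemma binomial_chernoff:
  assumes p: "p \<in> {0..1}" and sub: "\<And>k. k \<in> K \<Longrightarrow> c * a \<le> c * real k"
  shows "measure_pmf.prob (binomial_pmf n p) K \<le>
         exp (real n * p * (exp c - 1) - c * a)"
proof -
  have "measure_pmf.prob (binomial_pmf n p) K =
        measure_pmf.expectation (binomial_pmf n p) (indicator K)"
    by simp
  also have "\<dots> \<le> measure_pmf.expectation (binomial_pmf n p) (\<lambda>k. exp (- (c * a)) * exp (c * real k))"
    using p sub by (intro integral_mono integrable_binomial_pmf)
      (auto simp: indicator_def mult_exp_exp)
  also have "\<dots> = exp (- (c * a)) * (1 - p + p * exp c) ^ n"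
    by (simp add: binomial_mgf[OF p])
  also have "\<dots> \<le> exp (- (c * a)) * exp (p * (exp c - 1)) ^ n"
  proof (intro mult_left_mono power_mono)
    show "1 - p + p * exp c \<le> exp (p * (exp c - 1))"
      using exp_ge_add_one_self[of "p * (exp c - 1)"] by (simp add: algebra_simps)
  qed (use p in auto)
  also have "\<dots> = exp (real n * p * (exp c - 1) - c * a)"
    by (simp add: exp_of_nat_mult[symmetric] mult_exp_exp algebra_simps)
  finally show ?thesis .
qed

text \<open>Both differences vanish at 1 and are nonincreasing on the interval, with derivatives
  \<open>- ((1 - x)^2 / x)\<close> and \<open>ln x + 1 - x\<close>. They turn the optimal Chernoff
  exponents of the upper and the lower tail into quadratic ones.\<close>

lemma ln_quadratic_bounds:
  fixes y :: real
  assumes "0 < y" "y \<le> 1"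
  shows "(1 - y)\<^sup>2 / 2 \<le> y - 1 - ln y" and "(1 - y)\<^sup>2 / 2 \<le> y * ln y - y + 1"
proof -
  define f where "f = (\<lambda>y::real. y - 1 - ln y - (1 - y)\<^sup>2 / 2)"
  have "f 1 \<le> f y"
  proof (rule DERIV_nonpos_imp_nonincreasing[OF assms(2)])
    fix x assume x: "y \<le> x" "x \<le> 1"
    have "(f has_real_derivative (2 - x - 1 / x)) (at x)"
      unfolding f_def using x assms
      by (auto intro!: derivative_eq_intros simp: field_simps power2_eq_square)
    moreover have "2 - x - 1 / x \<le> 0"
    proof -
      have "2 - x - 1 / x = - ((1 - x)\<^sup>2 / x)"
        using x assms by (simp add: field_simps power2_eq_square)
      then show ?thesis using x assms by simp
    qed
    ultimately show "\<exists>D. (f has_real_derivative D) (at x) \<and> D \<le> 0" by blast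
  qed
  then show "(1 - y)\<^sup>2 / 2 \<le> y - 1 - ln y"
    by (simp add: f_def)
  define g where "g = (\<lambda>y::real. y * ln y - y + 1 - (1 - y)\<^sup>2 / 2)"
  have "g 1 \<le> g y"
  proof (rule DERIV_nonpos_imp_nonincreasing[OF assms(2)])
    fix x assume x: "y \<le> x" "x \<le> 1"
    have "(g has_real_derivative (ln x + 1 - x)) (at x)"
      unfolding g_def using x assms
      by (auto intro!: derivative_eq_intros simp: field_simps power2_eq_square)
    moreover have "ln x + 1 - x \<le> 0"
      using ln_le_minus_one[of x] x assms by simp
    ultimately show "\<exists>D. (g has_real_derivative D) (at x) \<and> D \<le> 0" by blast
  qed
  then show "(1 - y)\<^sup>2 / 2 \<le> y * ln y - y + 1"
    by (simp add: g_def)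
qed

lemma binomial_upper_tail:
  assumes "0 \<le> p" "p \<le> L" "L \<le> 1" "0 < L" "L \<le> T"
  shows "measure_pmf.prob (binomial_pmf n p) {k. real k > real n * T} \<le>
         exp (- (real n * (T - L)\<^sup>2 / (2 * T)))"
proof -
  \<comment> \<open>The minimiser of the Chernoff exponent \<open>L * (exp c - 1) - c * T\<close>;
    the success probability is raised from \<open>p\<close> to \<open>L\<close> before it is
    used.\<close>
  define c where "c = ln (T / L)"
  have T: "T > 0" using assms by simp
  have c: "exp c = T / L" "c \<ge> 0" "c = - ln (L / T)"
    using T assms by (simp_all add: c_def) (simp add: ln_div)
  have "(T - L)\<^sup>2 / (2 * T) = T * ((1 - L / T)\<^sup>2 / 2)"
    using T by (simp add: field_simps power2_eq_square)
  also have "\<dots> \<le> T * (L / T - 1 - ln (L / T))"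
    using ln_quadratic_bounds(1)[of "L / T"] T assms by (intro mult_left_mono) auto
  also have "\<dots> = c * T - L * (exp c - 1)"
    using T assms(4) c by (simp add: field_simps)
  finally have key: "L * (exp c - 1) - c * T \<le> - ((T - L)\<^sup>2 / (2 * T))"
    by simp
  have "measure_pmf.prob (binomial_pmf n p) {k. real k > real n * T} \<le>
        measure_pmf.prob (binomial_pmf n L) {k. real k > real n * T}"
    using assms by (intro binomial_upper_tail_mono) auto
  also have "\<dots> \<le> exp (real n * L * (exp c - 1) - c * (real n * T))"
    using assms c(2) by (intro binomial_chernoff mult_left_mono) auto
  also have "\<dots> \<le> exp (- (real n * (T - L)\<^sup>2 / (2 * T)))"
    using mult_left_mono[OF key, of "real n"] by (simp add: algebra_simps)
  finally show ?thesis .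
qed

lemma binomial_lower_tail:
  assumes "0 \<le> H" "H \<le> p" "p \<le> 1" "0 < T" "T \<le> H"
  shows "measure_pmf.prob (binomial_pmf n p) {k. real k > real n * T} \<ge>
         1 - exp (- (real n * (H - T)\<^sup>2 / (2 * H)))"
proof -
  \<comment> \<open>The same minimiser for success probability \<open>H\<close>. It is at most 0 as
    \<open>T \<le> H\<close>, which selects the lower tail.\<close>
  define c where "c = ln (T / H)"
  have H: "H > 0" using assms by simp
  have c: "exp c = T / H" "c \<le> 0"
    using H assms by (auto simp: c_def)
  have "(H - T)\<^sup>2 / (2 * H) = H * ((1 - T / H)\<^sup>2 / 2)"
    using H by (simp add: field_simps power2_eq_square)
  also have "\<dots> \<le> H * (T / H * ln (T / H) - T / H + 1)"
    using ln_quadratic_bounds(2)[of "T / H"] H assms by (intro mult_left_mono) auto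
  also have "\<dots> = c * T - H * (exp c - 1)"
    using H unfolding c_def[symmetric] c by (simp add: field_simps)
  finally have key: "H * (exp c - 1) - c * T \<le> - ((H - T)\<^sup>2 / (2 * H))"
    by simp
  have "measure_pmf.prob (binomial_pmf n H) {k. real k \<le> real n * T} \<le>
        exp (real n * H * (exp c - 1) - c * (real n * T))"
    using assms c(2) by (intro binomial_chernoff mult_left_mono_neg) auto
  also have "\<dots> \<le> exp (- (real n * (H - T)\<^sup>2 / (2 * H)))"
    using mult_left_mono[OF key, of "real n"] by (simp add: algebra_simps)
  finally have *: "measure_pmf.prob (binomial_pmf n H) {k. real k \<le> real n * T} \<le> \<dots>" .
  have "- {k. real k \<le> real n * T} = {k. real k > real n * T}" by auto
  then have "measure_pmf.prob (binomial_pmf n H) {k. real k > real n * T} =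
      1 - measure_pmf.prob (binomial_pmf n H) {k. real k \<le> real n * T}"
    using measure_pmf.prob_compl[of "{k. real k \<le> real n * T}" "binomial_pmf n H"]
    by (simp add: Compl_eq_Diff_UNIV)
  moreover have "\<dots> \<ge> 1 - exp (- (real n * (H - T)\<^sup>2 / (2 * H)))"
    using * by simp
  moreover have "measure_pmf.prob (binomial_pmf n H) {k. real k > real n * T} \<le>
     measure_pmf.prob (binomial_pmf n p) {k. real k > real n * T}"
    using assms by (intro binomial_upper_tail_mono) auto
  ultimately show ?thesis by linarith
qed

section \<open>Binomial moments and the tail bounds derived from them\<close>

lemma binomial_moment_1:
  assumes "p \<in> {0..1}"
  shows "measure_pmf.expectation (binomial_pmf n p) (\<lambda>k. real k - c) = real n * p - c"
proof (induction n arbitrary: c)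
  case (Suc n)
  from Suc[of "c - 1"] Suc[of c] show ?case
    using assms by (simp add: expectation_binomial_Suc algebra_simps)
qed (use assms in \<open>simp add: expectation_binomial_0\<close>)

lemma binomial_moment_2:
  assumes "p \<in> {0..1}"
  shows "measure_pmf.expectation (binomial_pmf n p) (\<lambda>k. (real k - c)\<^sup>2) =
         real n * p * (1 - p) + (real n * p - c)\<^sup>2"
proof (induction n arbitrary: c)
  case (Suc n)
  have *: "real (Suc k) - c = real k - (c - 1)" for k by simp
  show ?case
    unfolding expectation_binomial_Suc[OF assms] * Suc
    by (simp add: algebra_simps power2_eq_square)
qed (use assms in \<open>simp add: expectation_binomial_0\<close>)

text \<open>The centre \<open>c\<close> is arbitrary because a success in the recursion shifts it to
  \<open>c - 1\<close>. The coefficients come from the central moments \<open>v n\<close>,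
  \<open>v n * (1 - 2 * p)\<close> and
  \<open>3 * (v n)^2 + v n * (1 - 6 * p * (1 - p))\<close>.\<close>

lemma binomial_moment_4:
  assumes "p \<in> {0..1}"
  defines "v n \<equiv> real n * p * (1 - p)"
  shows "measure_pmf.expectation (binomial_pmf n p) (\<lambda>k. (real k - c) ^ 4) =
         3 * (v n)\<^sup>2 + v n * (1 - 6 * p * (1 - p)) + 4 * v n * (1 - 2 * p) * (real n * p - c)
         + 6 * v n * (real n * p - c)\<^sup>2 + (real n * p - c) ^ 4"
proof (induction n arbitrary: c)
  case (Suc n)
  have *: "real (Suc k) - c = real k - (c - 1)" for k by simp
  have eq: "real (Suc n) = real n + 1" by simp
  show ?case
    unfolding expectation_binomial_Suc[OF assms(1)] * Suc unfolding v_def eq by algebra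
qed (use assms in \<open>simp add: expectation_binomial_0\<close>)

lemma binomial_prob_ge_expectation:
  assumes p: "p \<in> {0..1}"
    and "\<And>k. f k \<le> indicator {k. real k > a} k"
  shows "measure_pmf.expectation (binomial_pmf n p) f \<le>
         measure_pmf.prob (binomial_pmf n p) {k. real k > a}"
proof -
  have "measure_pmf.expectation (binomial_pmf n p) f \<le>
        measure_pmf.expectation (binomial_pmf n p) (indicator {k. real k > a})"
    using assms by (intro integral_mono integrable_binomial_pmf) auto
  then show ?thesis by simp
qed

text \<open>Take expectations of a quadratic minorant of the indicator: with
  \<open>y = (k - a) / c\<close>, the value \<open>4 * y - 4 * y^2 = 1 - (2 * y - 1)^2\<close> is at
  most 1, and at most 0 for \<open>y \<le> 0\<close>.\<close>

lemma binomial_cantelli: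
  fixes n :: nat and p a :: real
  defines "v \<equiv> real n * p * (1 - p)" and "s \<equiv> real n * p - a"
  assumes p: "p \<in> {0..1}" and pos: "0 < s"
  shows "s\<^sup>2 / (v + s\<^sup>2) \<le> measure_pmf.prob (binomial_pmf n p) {k. real k > a}"
proof -
  let ?E = "measure_pmf.expectation (binomial_pmf n p)"
  have v: "v \<ge> 0" using p by (simp add: v_def)
  \<comment> \<open>This scale maximises the expectation
    \<open>4 / c * s - 4 / c^2 * (v + s^2)\<close> of the minorant.\<close>
  define c where "c = 2 * (v + s\<^sup>2) / s"
  have vs: "v + s\<^sup>2 > 0" using v pos by (simp add: add_nonneg_pos)
  have c: "c > 0" using vs pos by (simp add: c_def)
  have "?E (\<lambda>k. 4 / c * (real k - a) - 4 / c\<^sup>2 * (real k - a)\<^sup>2) = 4 / c * s - 4 / c\<^sup>2 * (v + s\<^sup>2)"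
    using p by (subst Bochner_Integration.integral_diff)
      (auto simp: binomial_moment_1[of p n 0, simplified] binomial_moment_2 v_def s_def)
  also have "\<dots> = s\<^sup>2 / (v + s\<^sup>2)"
  proof -
    define w where "w = v + s\<^sup>2"
    have w: "w > 0" using vs by (simp add: w_def)
    have "4 / c * s - 4 / c\<^sup>2 * w = s\<^sup>2 / w"
      unfolding c_def w_def[symmetric] using w pos
      by (simp add: field_simps power2_eq_square)
    then show ?thesis by (simp add: w_def)
  qed
  finally have "s\<^sup>2 / (v + s\<^sup>2) = ?E (\<lambda>k. 4 / c * (real k - a) - 4 / c\<^sup>2 * (real k - a)\<^sup>2)" ..
  also have "\<dots> \<le> measure_pmf.prob (binomial_pmf n p) {k. real k > a}"
  proof (rule binomial_prob_ge_expectation[OF p])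
    fix k
    define y where "y = (real k - a) / c"
    have eq: "4 / c * (real k - a) - 4 / c\<^sup>2 * (real k - a)\<^sup>2 = 4 * y - 4 * y\<^sup>2"
      by (simp add: y_def power_divide)
    have "4 * y - 4 * y\<^sup>2 \<le> 1"
      using zero_le_power2[of "2 * y - 1"] by (simp add: power2_eq_square algebra_simps)
    moreover have "4 * y - 4 * y\<^sup>2 \<le> 0" if "real k \<le> a"
    proof -
      have "y \<le> 0" using that c by (simp add: y_def divide_le_0_iff)
      then show ?thesis by (smt (verit) zero_le_power2)
    qed
    ultimately show "4 / c * (real k - a) - 4 / c\<^sup>2 * (real k - a)\<^sup>2 \<le> indicator {k. real k > a} k"
      unfolding eq by (auto simp: indicator_def)
  qed
  finally show ?thesis .
qed

text \<open>
  A lower bound from the first, second and fourth moments: \<open>2 y + 3 y\<^sup>2 - y ^ 4 = y (y + 1)\<^sup>2 (2 - y)\<close>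
  is at most \<open>0\<close> for \<open>y \<le> 0\<close> and at most \<open>5\<close> everywhere.
\<close>

lemma binomial_fourth_moment_bound:
  fixes n :: nat and p s w a :: real
  defines "v \<equiv> real n * p * (1 - p)"
  assumes p: "p \<in> {0..1}" and s: "0 \<le> s" "s \<le> real n * p - a" and w: "0 \<le> w"
  shows "(2 * s * w + 3 * (v + s\<^sup>2) * w\<^sup>2 - (3 * v\<^sup>2 + v + 4 * v * s + 6 * v * s\<^sup>2 + s ^ 4) * w ^ 4) / 5
         \<le> measure_pmf.prob (binomial_pmf n p) {k. real k > a}"
proof -
  let ?E = "measure_pmf.expectation (binomial_pmf n p)"
  \<comment> \<open>Centring at \<open>b \<ge> a\<close> makes the offset of the mean exactly
    \<open>s\<close>, while \<open>real k \<le> a\<close> still implies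
    \<open>y \<le> 0\<close>.\<close>
  define b where "b = real n * p - s"
  have b: "b \<ge> a" and bs: "real n * p - b = s" using s by (auto simp: b_def)
  let ?f = "\<lambda>k. 2 / 5 * w * (real k - b) + 3 / 5 * w\<^sup>2 * (real k - b)\<^sup>2 - 1 / 5 * w ^ 4 * (real k - b) ^ 4"
  let ?M4 = "3 * v\<^sup>2 + v * (1 - 6 * p * (1 - p)) + 4 * v * (1 - 2 * p) * s + 6 * v * s\<^sup>2 + s ^ 4"
  have v: "v \<ge> 0" using p by (simp add: v_def)
  have Ef: "?E ?f = 2 / 5 * w * s + 3 / 5 * w\<^sup>2 * (v + s\<^sup>2) - 1 / 5 * w ^ 4 * ?M4"
  proof -
    have "?E ?f = ?E (\<lambda>k. 2 / 5 * w * (real k - b) + 3 / 5 * w\<^sup>2 * (real k - b)\<^sup>2) -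
        ?E (\<lambda>k. 1 / 5 * w ^ 4 * (real k - b) ^ 4)"
      using p by (intro Bochner_Integration.integral_diff integrable_binomial_pmf) auto
    also have "?E (\<lambda>k. 2 / 5 * w * (real k - b) + 3 / 5 * w\<^sup>2 * (real k - b)\<^sup>2) =
        ?E (\<lambda>k. 2 / 5 * w * (real k - b)) + ?E (\<lambda>k. 3 / 5 * w\<^sup>2 * (real k - b)\<^sup>2)"
      using p by (intro Bochner_Integration.integral_add integrable_binomial_pmf) auto
    finally show ?thesis
      using p bs by (simp add: binomial_moment_1[of p n 0, simplified]
          binomial_moment_2 binomial_moment_4 v_def)
  qed
  have "?M4 \<le> 3 * v\<^sup>2 + v + 4 * v * s + 6 * v * s\<^sup>2 + s ^ 4"
  proof -
    have "v * (1 - 6 * p * (1 - p)) \<le> v * 1"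
      using p v by (intro mult_left_mono) auto
    moreover have "4 * v * s * (1 - 2 * p) \<le> 4 * v * s * 1"
      using p v s by (intro mult_left_mono) auto
    ultimately show ?thesis by (simp add: algebra_simps)
  qed
  from mult_left_mono[OF this, of "w ^ 4"] have M4:
    "w ^ 4 * ?M4 \<le> w ^ 4 * (3 * v\<^sup>2 + v + 4 * v * s + 6 * v * s\<^sup>2 + s ^ 4)"
    using w by simp
  have "?E ?f \<le> measure_pmf.prob (binomial_pmf n p) {k. real k > a}"
  proof (rule binomial_prob_ge_expectation[OF p])
    fix k
    define y where "y = w * (real k - b)"
    have eq: "?f k = (2 * y + 3 * y\<^sup>2 - y ^ 4) / 5"
      by (simp add: y_def power_mult_distrib)
    have "5 - 2 * y - 3 * y\<^sup>2 + y ^ 4 = (y\<^sup>2 - 2)\<^sup>2 + (y - 1)\<^sup>2"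
      by algebra
    then have le5: "2 * y + 3 * y\<^sup>2 - y ^ 4 \<le> 5"
      by (smt (verit) zero_le_power2)
    have "2 * y + 3 * y\<^sup>2 - y ^ 4 \<le> 0" if "real k \<le> a"
    proof -
      have "y \<le> 0" using that b w by (simp add: y_def mult_nonneg_nonpos)
      then have "(- y) * ((y + 1)\<^sup>2 * (2 - y)) \<ge> 0" by (intro mult_nonneg_nonneg) auto
      moreover have "(- y) * ((y + 1)\<^sup>2 * (2 - y)) = - (2 * y + 3 * y\<^sup>2 - y ^ 4)" by algebra
      ultimately show ?thesis by linarith
    qed
    then show "?f k \<le> indicator {k. real k > a} k"
      unfolding eq using le5 by (auto simp: indicator_def)
  qed
  with M4 show ?thesis
    unfolding Ef by (simp only: algebra_simps) simp
qed

text \<open>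
  The right-hand side is five times the fourth moment bound for \<open>s = \<kappa> \<sigma>\<close>, \<open>w = 5 / (8 \<sigma>)\<close>, where \<open>\<sigma>\<close> is
  the standard deviation. Its difference to the left-hand side is concave in \<open>\<kappa>\<close>,
  so that the largest \<open>\<kappa>\<close> decides.
\<close>

lemma tail_polynomial_bound:
  fixes \<tau> \<kappa> e :: real
  assumes \<tau>: "0 < \<tau>" "\<tau> \<le> 73 / 100" and \<kappa>: "0 \<le> \<kappa>" "\<kappa>\<^sup>2 \<le> 4 / 5 * \<tau>\<^sup>2"
    and e: "e \<le> 1 / 10 + 2 * \<tau> / (2 + \<tau>)"
  shows "10 * \<kappa>\<^sup>2 / (\<tau> * ((3 - \<tau>) * (1 + \<tau>)))
         \<le> 5 / 4 * \<kappa> + 75 / 64 * (1 + \<kappa>\<^sup>2) - 625 / 4096 * (3 + e + 6 * \<kappa>\<^sup>2 + \<kappa> ^ 4)"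
proof -
  define g where "g = (3 - \<tau>) * (1 + \<tau>)"
  have g: "g > 0" using \<tau> by (simp add: g_def)
  \<comment> \<open>The largest admissible \<open>\<kappa>\<close>, rounded up:
    \<open>sqrt (4 / 5)\<close> is slightly below \<open>8945 / 10000\<close>.\<close>
  define K where "K = 8945 / 10000 * \<tau>"
  have K: "K > 0" using \<tau> by (simp add: K_def)
  have "\<kappa> \<le> K"
  proof (rule power2_le_imp_le)
    have "4 / 5 * \<tau>\<^sup>2 \<le> (8945 / 10000)\<^sup>2 * \<tau>\<^sup>2"
      by (intro mult_right_mono) (auto simp: power2_eq_square)
    then show "\<kappa>\<^sup>2 \<le> K\<^sup>2" using \<kappa>(2) unfolding K_def power_mult_distrib by linarith
  qed (use K in simp)
  \<comment> \<open>Concavity enters through \<open>y^2 \<le> y\<close> and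
    \<open>y^4 \<le> y\<close>, which reduce the claim to \<open>\<kappa> = 0\<close>, where the
    difference is \<open>c \<ge> 0\<close>, and to \<open>\<kappa> = K\<close>, which is
    \<open>endpoint\<close>.\<close>
  define y where "y = \<kappa> / K"
  have y: "0 \<le> y" "y \<le> 1" and \<kappa>y: "\<kappa> = y * K"
    using \<kappa> K \<open>\<kappa> \<le> K\<close> by (auto simp: y_def)
  have y2: "y\<^sup>2 \<le> y" and y4: "y ^ 4 \<le> y"
    using power_decreasing[of 1 2 y] power_decreasing[of 1 4 y] y by auto
  define c where "c = 75 / 64 - 625 / 4096 * (3 + e)"
  have c: "c \<ge> 677 / 1000 - 82 / 1000 * \<tau>"
  proof -
    \<comment> \<open>Nearly the tangent of this concave function at \<open>73 / 100\<close>, the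
      largest admissible \<open>\<tau>\<close>.\<close>
    have "2 * \<tau> / (2 + \<tau>) \<le> 143 / 1000 + 537 / 1000 * \<tau>"
    proof -
      have "0 \<le> 286 - 783 * \<tau> + 537 * \<tau>\<^sup>2"
      proof -
        have "286 - 783 * \<tau> + 537 * \<tau>\<^sup>2 = 537 * (\<tau> - 783 / 1074)\<^sup>2 + (286 - 783\<^sup>2 / 2148)"
          by (simp add: power2_eq_square algebra_simps)
        also have "\<dots> \<ge> 0" by simp
        finally show ?thesis .
      qed
      moreover have "(143 / 1000 + 537 / 1000 * \<tau>) * (2 + \<tau>) =
          2 * \<tau> + (286 - 783 * \<tau> + 537 * \<tau>\<^sup>2) / 1000"
        by (simp add: field_simps power2_eq_square)
      ultimately have "2 * \<tau> \<le> (143 / 1000 + 537 / 1000 * \<tau>) * (2 + \<tau>)"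
        by simp
      then show ?thesis using \<tau> by (simp only: pos_divide_le_eq)
    qed
    with e have "e \<le> 243 / 1000 + 537 / 1000 * \<tau>" by linarith
    then have "625 * (3 + e) \<le> 625 * (3243 / 1000 + 537 / 1000 * \<tau>)" by simp
    also have "\<dots> \<le> 4096 * (75 / 64 - 677 / 1000 + 82 / 1000 * \<tau>)"
      using \<tau> by simp
    finally have "625 / 4096 * (3 + e) \<le> 75 / 64 - 677 / 1000 + 82 / 1000 * \<tau>"
      by simp
    then show ?thesis unfolding c_def by (simp only: algebra_simps)
  qed
  have \<tau>2: "\<tau>\<^sup>2 \<le> 5329 / 10000"
    using power_mono[of \<tau> "73/100" 2] \<tau> by (simp add: power2_eq_square)
  have endpoint: "10 * K\<^sup>2 / (\<tau> * g) \<le> c + 5 / 4 * K + (75 / 64 - 6 * 625 / 4096) * K\<^sup>2 - 625 / 4096 * K ^ 4"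
  proof -
    \<comment> \<open>A quadratic in \<open>\<tau>\<close> below the right-hand side; multiplying by
      \<open>g\<close> then leaves a polynomial inequality in \<open>\<tau>\<close>.\<close>
    define A where "A = 677 / 1000 + 1036 / 1000 * \<tau> + 153 / 1000 * \<tau>\<^sup>2"
    have "K ^ 4 \<le> 641 / 1000 * \<tau> ^ 4"
      using \<tau> unfolding K_def power_mult_distrib by (intro mult_right_mono) (simp_all add: power4_eq_xxxx)
    also have "\<tau> ^ 4 = \<tau>\<^sup>2 * \<tau>\<^sup>2" by algebra
    also have "641 / 1000 * (\<tau>\<^sup>2 * \<tau>\<^sup>2) \<le> 641 / 1000 * (5329 / 10000 * \<tau>\<^sup>2)"
      using \<tau>2 by (intro mult_left_mono mult_right_mono) auto
    finally have K4: "K ^ 4 \<le> 342 / 1000 * \<tau>\<^sup>2" using zero_le_power2[of \<tau>] by linarith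
    have K2: "K\<^sup>2 = (8945 / 10000)\<^sup>2 * \<tau>\<^sup>2" by (simp only: K_def power_mult_distrib)
    have A: "A \<le> c + 5 / 4 * K + (75 / 64 - 6 * 625 / 4096) * K\<^sup>2 - 625 / 4096 * K ^ 4"
    proof -
      have "(75 / 64 - 6 * 625 / 4096) * K\<^sup>2 \<ge> 2051 / 10000 * \<tau>\<^sup>2"
        unfolding K2 using zero_le_power2[of \<tau>] by (simp add: power2_eq_square)
      moreover have "625 / 4096 * K ^ 4 \<le> 522 / 10000 * \<tau>\<^sup>2"
        using K4 zero_le_power2[of \<tau>] by linarith
      ultimately have "c + 5 / 4 * K + (75 / 64 - 6 * 625 / 4096) * K\<^sup>2 - 625 / 4096 * K ^ 4 \<ge>
          677 / 1000 - 82 / 1000 * \<tau> + 5 / 4 * K + (2051 / 10000 - 522 / 10000) * \<tau>\<^sup>2"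
        using c by (simp add: algebra_simps)
      moreover have "A \<le> 677 / 1000 - 82 / 1000 * \<tau> + 5 / 4 * K + (2051 / 10000 - 522 / 10000) * \<tau>\<^sup>2"
      proof -
        have "\<tau>\<^sup>2 \<le> \<tau>" using power_decreasing[of 1 2 \<tau>] \<tau> by simp
        then show ?thesis unfolding A_def K_def using \<tau> by simp
      qed
      ultimately show ?thesis by (rule order_trans[rotated])
    qed
    have "10 * K\<^sup>2 / (\<tau> * g) = 10 * (8945 / 10000)\<^sup>2 * \<tau> / g"
      unfolding K2 using \<tau> g by (simp add: field_simps power2_eq_square)
    also have "\<dots> \<le> A"
    proof -
      have t3: "\<tau>\<^sup>2 * \<tau> \<le> 73 / 100 * \<tau>\<^sup>2" using mult_left_mono[OF \<tau>(2), of "\<tau>\<^sup>2"] by simp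
      have t4: "\<tau>\<^sup>2 * \<tau>\<^sup>2 \<le> 5329 / 10000 * \<tau>\<^sup>2" using mult_right_mono[OF \<tau>2, of "\<tau>\<^sup>2"] by simp
      have "A * g = 2031 / 1000 + 4462 / 1000 * \<tau> + 1854 / 1000 * \<tau>\<^sup>2 - 730 / 1000 * (\<tau>\<^sup>2 * \<tau>) - 153 / 1000 * (\<tau>\<^sup>2 * \<tau>\<^sup>2)"
        unfolding A_def g_def by (simp add: field_simps power2_eq_square)
      then have "A * g \<ge> 2031 / 1000 + 4462 / 1000 * \<tau> + 1239 / 1000 * \<tau>\<^sup>2"
        using t3 t4 zero_le_power2[of \<tau>] by linarith
      moreover have "2031 / 1000 + 4462 / 1000 * \<tau> + 1239 / 1000 * \<tau>\<^sup>2 \<ge> 10 * (8945 / 10000)\<^sup>2 * \<tau>"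
      proof -
        have "0 \<le> (73 / 100 - \<tau>) * (2 - 1239 / 1000 * \<tau>)"
          using \<tau> by (intro mult_nonneg_nonneg) auto
        also have "\<dots> = 146 / 100 - 290447 / 100000 * \<tau> + 1239 / 1000 * \<tau>\<^sup>2"
          by (simp add: field_simps power2_eq_square)
        finally show ?thesis using \<tau> by (simp add: power2_eq_square)
      qed
      ultimately show ?thesis using g by (simp add: divide_le_eq)
    qed
    finally show ?thesis using A by linarith
  qed
  \<comment> \<open>Concerns the coefficient of \<open>\<kappa>^2\<close> in the difference of the
    two sides: its sign allows \<open>y^2 * K^2\<close> to be raised to
    \<open>y * K^2\<close>.\<close>
  have coef: "10 / (\<tau> * g) \<ge> 75 / 64 - 6 * 625 / 4096"
  proof -
    have "\<tau> * g \<le> 1 * 4"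
      using \<tau> zero_le_power2[of "\<tau> - 1"] g
      by (intro mult_mono) (auto simp: g_def power2_eq_square algebra_simps)
    then have "10 / (\<tau> * g) \<ge> 10 / 4" using \<tau> g by (intro divide_left_mono) auto
    then show ?thesis by simp
  qed
  have "(10 / (\<tau> * g) - (75 / 64 - 6 * 625 / 4096)) * \<kappa>\<^sup>2 \<le> (10 / (\<tau> * g) - (75 / 64 - 6 * 625 / 4096)) * (y * K\<^sup>2)"
    unfolding \<kappa>y power_mult_distrib using coef y2 by (intro mult_left_mono mult_right_mono) auto
  also have "\<dots> = y * (10 * K\<^sup>2 / (\<tau> * g) - (75 / 64 - 6 * 625 / 4096) * K\<^sup>2)"
    by (simp add: algebra_simps)
  also have "\<dots> \<le> y * (c + 5 / 4 * K - 625 / 4096 * K ^ 4)"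
    using endpoint y by (intro mult_left_mono) auto
  also have "\<dots> \<le> c + 5 / 4 * \<kappa> - 625 / 4096 * \<kappa> ^ 4"
  proof -
    have "0 \<le> c" using c \<tau> by simp
    then have "y * c \<le> c" using y mult_right_mono[of y 1 c] by simp
    moreover have "\<kappa> ^ 4 \<le> y * K ^ 4"
      unfolding \<kappa>y power_mult_distrib using y4 by (intro mult_right_mono) auto
    ultimately show ?thesis by (simp add: \<kappa>y algebra_simps)
  qed
  finally have "10 / (\<tau> * g) * \<kappa>\<^sup>2 \<le>
      c + 5 / 4 * \<kappa> - 625 / 4096 * \<kappa> ^ 4 + (75 / 64 - 6 * 625 / 4096) * \<kappa>\<^sup>2"
    by (simp only: left_diff_distrib diff_le_eq)
  also have "\<dots> = 5 / 4 * \<kappa> + 75 / 64 * (1 + \<kappa>\<^sup>2) - 625 / 4096 * (3 + e + 6 * \<kappa>\<^sup>2 + \<kappa> ^ 4)"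
    unfolding c_def by (simp add: field_simps)
  finally show ?thesis by (simp add: g_def)
qed

text \<open>
  When the tester makes a single iteration, the exponential bound only yields \<open>z = 1 - \<delta>\<close> for the
  probability that a bad pair is rejected, which is too weak as bad pairs are drawn with probability
  below 1. The prefactor is the lower bound for the probability of a bad pair.
\<close>

lemma binomial_tail_single_round:
  fixes n :: nat and p a \<tau> z :: real
  defines "v \<equiv> real n * p * (1 - p)" and "s \<equiv> real n * p - a"
  assumes p: "p \<in> {0..1}" and \<tau>: "0 < \<tau>" "\<tau> \<le> 1" and z: "0 < z" "z \<le> 2 / 5 * \<tau>\<^sup>2"
    and s: "s \<ge> 0" "s\<^sup>2 \<ge> 2 * z * v" and v: "v \<ge> 32 * z * ((1 + \<tau> / 2) / \<tau>)\<^sup>2"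
  shows "z \<le> \<tau> * (1 - (1 - \<tau>)\<^sup>2 / 4) * measure_pmf.prob (binomial_pmf n p) {k. real k > a}"
    (is "_ \<le> _ * ?P")
proof -
  have coef: "\<tau> * (1 - (1 - \<tau>)\<^sup>2 / 4) = \<tau> * ((3 - \<tau>) * (1 + \<tau>)) / 4"
    by (simp add: field_simps power2_eq_square)
  have Bpos: "\<tau> * ((3 - \<tau>) * (1 + \<tau>)) > 0" using \<tau> by simp
  have "32 * z * ((1 + \<tau> / 2) / \<tau>)\<^sup>2 > 0" using z \<tau> by simp
  then have vpos: "v > 0" using v by linarith
  have spos: "s > 0" using s z vpos by (smt (verit) mult_pos_pos zero_power2)
  \<comment> \<open>Cantelli's inequality handles large \<open>\<tau>\<close>. For small
    \<open>\<tau>\<close> the fourth moment bound is applied with \<open>s = 0\<close> if the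
    variance is at most 10, and with \<open>s = \<kappa> * sqrt v\<close> otherwise.\<close>
  consider (A) "\<tau> \<ge> 73 / 100" | (B) "\<tau> \<le> 73 / 100" "v \<le> 10" | (C) "\<tau> \<le> 73 / 100" "v \<ge> 10"
    by linarith
  then show ?thesis
  proof cases
    case A
    have "v + s\<^sup>2 > 0" using vpos by (simp add: add_pos_nonneg)
    \<comment> \<open>The quotient \<open>s^2 / (v + s^2)\<close> increases with \<open>s^2\<close>,
      which is at least \<open>2 * z * v\<close>.\<close>
    then have "2 * z / (1 + 2 * z) \<le> s\<^sup>2 / (v + s\<^sup>2)"
      using s(2) z by (simp add: field_simps)
    also have "\<dots> \<le> ?P"
      using binomial_cantelli[OF p, of n a] spos unfolding v_def s_def by simp
    finally have P: "2 * z / (1 + 2 * z) \<le> ?P" .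
    have "1 + 2 * z \<le> \<tau> * ((3 - \<tau>) * (1 + \<tau>)) / 2"
    proof -
      have "0 \<le> (\<tau> - 73 / 100) * (1 - \<tau>) * (\<tau> + 1)"
        using \<tau> A by (intro mult_nonneg_nonneg) auto
      moreover have "(\<tau> - 73 / 100) * (175 / 100 - 33 / 100 * \<tau>) \<ge> 0"
        using \<tau> A by (intro mult_nonneg_nonneg) auto
      ultimately have "0 \<le> ((\<tau> - 73 / 100) * (1 - \<tau>) * (\<tau> + 1)
           + (\<tau> - 73 / 100) * (175 / 100 - 33 / 100 * \<tau>) + (91 * \<tau> + 75) / 10000) / 2"
        using \<tau> by simp
      also have "\<dots> = \<tau> * ((3 - \<tau>) * (1 + \<tau>)) / 2 - (1 + 4 / 5 * \<tau>\<^sup>2)"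
        by (simp add: field_simps power2_eq_square)
      finally have "1 + 4 / 5 * \<tau>\<^sup>2 \<le> \<tau> * ((3 - \<tau>) * (1 + \<tau>)) / 2" by simp
      moreover have "1 + 2 * z \<le> 1 + 4 / 5 * \<tau>\<^sup>2" using z by simp
      ultimately show ?thesis by (rule order_trans[rotated])
    qed
    then have "z * (1 + 2 * z) \<le> z * (\<tau> * ((3 - \<tau>) * (1 + \<tau>)) / 2)"
      using z by (intro mult_left_mono) auto
    also have "\<dots> = \<tau> * ((3 - \<tau>) * (1 + \<tau>)) / 4 * (2 * z)"
      by simp
    finally have "z * (1 + 2 * z) \<le> \<tau> * ((3 - \<tau>) * (1 + \<tau>)) / 4 * (2 * z)" .
    then have "z \<le> \<tau> * ((3 - \<tau>) * (1 + \<tau>)) / 4 * (2 * z / (1 + 2 * z))"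
      using z by (simp add: field_simps)
    also have "\<dots> \<le> \<tau> * ((3 - \<tau>) * (1 + \<tau>)) / 4 * ?P"
      using P Bpos by (intro mult_left_mono) auto
    finally show ?thesis unfolding coef .
  next
    case B
    \<comment> \<open>This choice maximises \<open>3 * v * w^2 - (3 * v^2 + v) * w^4\<close>. The
      denominator 620 below is \<open>20 * (3 * 10 + 1)\<close>, from
      \<open>v \<le> 10\<close>.\<close>
    define w where "w = sqrt (3 / (2 * (3 * v + 1)))"
    have w: "w \<ge> 0" "w\<^sup>2 = 3 / (2 * (3 * v + 1))" using vpos by (auto simp: w_def)
    have w4: "w ^ 4 = (3 / (2 * (3 * v + 1)))\<^sup>2"
      unfolding w(2)[symmetric] by (simp flip: power_mult)
    have "9 * v / 620 \<le> 9 * v / (20 * (3 * v + 1))"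
      using B vpos by (intro divide_left_mono) auto
    also have "\<dots> = (3 * v * w\<^sup>2 - (3 * v\<^sup>2 + v) * w ^ 4) / 5"
    proof -
      define u where "u = 3 * v + 1"
      have u: "u > 0" using vpos by (simp add: u_def)
      have "3 * v\<^sup>2 + v = v * u" by (simp add: u_def algebra_simps power2_eq_square)
      then show ?thesis
        unfolding w w4 u_def[symmetric] using u by (simp add: field_simps power2_eq_square)
    qed
    also have "\<dots> \<le> ?P"
      using binomial_fourth_moment_bound[OF p, of 0 n a w] w(1) s(1) unfolding v_def s_def by simp
    finally have P: "9 * v / 620 \<le> ?P" .
    have "\<tau> * 4 * 620 \<le> 32 * 9 * (1 + \<tau> / 2)\<^sup>2 * ((3 - \<tau>) * (1 + \<tau>))"
    proof -
      have "\<tau> * 4 * 620 \<le> 32 * 9 * ((1 + \<tau>) * (227 / 100 * (1 + \<tau>)))"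
        using zero_le_power2[of "\<tau> - 1"] \<tau> by (simp add: algebra_simps power2_eq_square)
      also have "\<dots> \<le> 32 * 9 * ((1 + \<tau> / 2)\<^sup>2 * ((3 - \<tau>) * (1 + \<tau>)))"
        using \<tau> B by (intro mult_left_mono mult_mono) (auto simp: power2_eq_square algebra_simps)
      finally show ?thesis by (simp add: mult.assoc)
    qed
    then have "z * (\<tau> * 4 * 620) \<le> z * (32 * 9 * (1 + \<tau> / 2)\<^sup>2 * ((3 - \<tau>) * (1 + \<tau>)))"
      using z by (intro mult_left_mono) auto
    then have "z \<le> z * (32 * 9 * (1 + \<tau> / 2)\<^sup>2 * ((3 - \<tau>) * (1 + \<tau>))) / (\<tau> * 4 * 620)"
      using \<tau> by (subst pos_le_divide_eq) auto
    also have "\<dots> = \<tau> * ((3 - \<tau>) * (1 + \<tau>)) / 4 * (9 * (32 * z * ((1 + \<tau> / 2) / \<tau>)\<^sup>2) / 620)"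
    proof -
      define G E where "G = (3 - \<tau>) * (1 + \<tau>)" and "E = 1 + \<tau> / 2"
      show ?thesis
        unfolding G_def[symmetric] E_def[symmetric]
        using \<tau> by (simp add: power_divide power2_eq_square)
    qed
    also have "\<dots> \<le> \<tau> * ((3 - \<tau>) * (1 + \<tau>)) / 4 * (9 * v / 620)"
      using v Bpos by (intro mult_left_mono divide_right_mono) auto
    also have "\<dots> \<le> \<tau> * ((3 - \<tau>) * (1 + \<tau>)) / 4 * ?P"
      using P Bpos by (intro mult_left_mono) auto
    finally show ?thesis unfolding coef .
  next
    case C
    define \<kappa> r where "\<kappa> = sqrt (2 * z)" and "r = sqrt v"
    have \<kappa>: "\<kappa> \<ge> 0" "\<kappa>\<^sup>2 = 2 * z" and r: "r > 0" "r\<^sup>2 = v"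
      using z vpos by (auto simp: \<kappa>_def r_def)
    \<comment> \<open>Divided by \<open>v^2\<close>, the fourth moment bound becomes
      \<open>3 + e + 6 * \<kappa>^2 + \<kappa>^4\<close>, with \<open>e\<close> collecting the lower
      order terms. The assumed lower bound on \<open>v\<close> controls
      \<open>4 * \<kappa> / r\<close>.\<close>
    define e where "e = 1 / v + 4 * \<kappa> / r"
    have "(\<kappa> * (4 + 2 * \<tau>) / \<tau>)\<^sup>2 \<le> r\<^sup>2"
    proof -
      have "(\<kappa> * (4 + 2 * \<tau>) / \<tau>)\<^sup>2 = 32 * z * ((1 + \<tau> / 2) / \<tau>)\<^sup>2"
        using \<kappa>(2) \<tau> by (simp add: power_divide power_mult_distrib) (simp add: power2_eq_square algebra_simps)
      then show ?thesis using v r by simp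
    qed
    then have "\<kappa> * (4 + 2 * \<tau>) / \<tau> \<le> r"
      by (rule power2_le_imp_le) (use r in simp)
    then have "4 * \<kappa> / r \<le> 2 * \<tau> / (2 + \<tau>)"
      using r(1) \<tau> by (simp add: field_simps)
    moreover have "1 / v \<le> 1 / 10" using C vpos by (simp add: field_simps)
    ultimately have e: "e \<le> 1 / 10 + 2 * \<tau> / (2 + \<tau>)" by (simp add: e_def)
    have s': "0 \<le> \<kappa> * r" "\<kappa> * r \<le> s"
    proof -
      have "(\<kappa> * r)\<^sup>2 \<le> s\<^sup>2" using s(2) by (simp only: power_mult_distrib \<kappa>(2) r(2))
      then show "\<kappa> * r \<le> s" by (rule power2_le_imp_le) (rule s(1))
    qed (use \<kappa> r in auto)
    have "10 * \<kappa>\<^sup>2 / (\<tau> * ((3 - \<tau>) * (1 + \<tau>)))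
         \<le> 5 / 4 * \<kappa> + 75 / 64 * (1 + \<kappa>\<^sup>2) - 625 / 4096 * (3 + e + 6 * \<kappa>\<^sup>2 + \<kappa> ^ 4)"
      using tail_polynomial_bound[OF \<tau>(1) C(1) \<kappa>(1) _ e] \<kappa>(2) z(2) by simp
    also have "\<dots> = 2 * (\<kappa> * r) * (5 / 8 / r) + 3 * (v + (\<kappa> * r)\<^sup>2) * (5 / 8 / r)\<^sup>2 -
        (3 * v\<^sup>2 + v + 4 * v * (\<kappa> * r) + 6 * v * (\<kappa> * r)\<^sup>2 + (\<kappa> * r) ^ 4) * (5 / 8 / r) ^ 4"
    proof -
      define i where "i = 1 / r"
      have ri: "r * i = 1" using r(1) by (simp add: i_def)
      have e_eq: "e = i\<^sup>2 + 4 * \<kappa> * i"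
        by (simp add: e_def i_def power_divide flip: r(2))
      have "5 / 8 / r = 5 / 8 * i" by (simp add: i_def)
      then show ?thesis
        unfolding e_eq r(2)[symmetric] using ri by algebra
    qed
    also have "\<dots> \<le> 5 * ?P"
      using binomial_fourth_moment_bound[OF p, of "\<kappa> * r" n a "5 / 8 / r"] s' r(1)
      unfolding v_def s_def by simp
    finally have "20 * z / (\<tau> * ((3 - \<tau>) * (1 + \<tau>))) \<le> 5 * ?P" by (simp add: \<kappa>)
    then show ?thesis unfolding coef using Bpos by (simp add: field_simps)
  qed
qed

subsection \<open>Formulas and the kernel\<close>

lemma finite_Supp: "finite (Supp \<phi>)"
  by (induction \<phi>) auto

lemma sat_cong:
  assumes "\<And>x. x \<in> Supp \<phi> \<Longrightarrow> \<sigma> x = \<rho> x"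
  shows "sat \<sigma> \<phi> \<longleftrightarrow> sat \<rho> \<phi>"
  using assms by (induction \<phi>) auto

lemma Supp_chain_formula: "Supp (chain_formula k vs) \<subseteq> set vs"
  by (induction k vs rule: chain_formula.induct) auto

text \<open>Chain formulas combine positive literals by conjunction and disjunction, and the bounds
  on \<open>k\<close> keep the recursion from reaching \<open>Bot\<close>.\<close>

lemma sat_chain_formula:
  assumes "0 < k" "k < 2 ^ length vs" "\<And>x. x \<in> set vs \<Longrightarrow> \<sigma> x = Some True"
  shows "sat \<sigma> (chain_formula k vs)"
  using assms by (induction k vs rule: chain_formula.induct) auto

lemma Supp_conj_lits:
  assumes "finite (dom \<sigma>)"
  shows "Supp (conj_lits \<sigma>) = dom \<sigma>"
proof -
  have "Supp (foldr (\<lambda>v. And (lit_formula (v, the (\<sigma> v)))) vs (Neg Bot)) = set vs" for vs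
    by (induction vs) auto
  then show ?thesis using assms by (simp add: conj_lits_def)
qed

lemma sat_conj_lits:
  assumes "finite (dom \<sigma>)" "dom \<sigma> \<subseteq> dom \<rho>"
  shows "sat \<rho> (conj_lits \<sigma>) \<longleftrightarrow> \<rho> |` dom \<sigma> = \<sigma>"
proof -
  have "sat \<rho> (foldr (\<lambda>v. And (lit_formula (v, the (\<sigma> v)))) vs (Neg Bot)) \<longleftrightarrow>
        (\<forall>v\<in>set vs. \<rho> v = \<sigma> v)" if "set vs \<subseteq> dom \<sigma>" for vs
    using that
  proof (induction vs)
    case (Cons v vs)
    then obtain b where b: "\<sigma> v = Some b" by auto
    then have "v \<in> dom \<rho>" using assms(2) by blast
    then obtain c where "\<rho> v = Some c" by blast
    note b this
    with Cons show ?case by auto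
  qed simp
  moreover have "(\<forall>v\<in>dom \<sigma>. \<rho> v = \<sigma> v) \<longleftrightarrow> \<rho> |` dom \<sigma> = \<sigma>"
    by (auto simp: restrict_map_def fun_eq_iff domIff)
  ultimately show ?thesis using assms(1) by (simp add: conj_lits_def)
qed

lemma finite_proj_models: "finite (proj_models \<phi> S)"
proof -
  have "models \<phi> \<subseteq> {\<sigma>. dom \<sigma> = Supp \<phi> \<and> ran \<sigma> \<subseteq> UNIV}"
    by (auto simp: models_def)
  moreover have "finite {\<sigma> :: assignment. dom \<sigma> = Supp \<phi> \<and> ran \<sigma> \<subseteq> UNIV}"
    by (rule finite_set_of_finite_maps) (auto simp: finite_Supp)
  ultimately show ?thesis
    unfolding proj_models_def by (blast intro: finite_subset)
qed

lemma dom_proj_models: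
  assumes "S \<subseteq> Supp \<phi>" "\<sigma> \<in> proj_models \<phi> S"
  shows "dom \<sigma> = S"
proof -
  obtain m where "dom m = Supp \<phi>" "\<sigma> = m |` S"
    using assms(2) by (auto simp: proj_models_def models_def)
  then show ?thesis using assms(1) by (simp add: Int_absorb1)
qed

lemma set_pmf_barbarik2_kernel:
  assumes "finite S" "dom \<sigma>1 = S" "dom \<sigma>2 = S" "\<sigma>1 \<noteq> \<sigma>2"
    and "\<phi>' \<in> set_pmf (barbarik2_kernel V \<phi> \<sigma>1 \<sigma>2)"
  obtains l where "fst l \<in> S"
    "\<phi>' = And (And (And \<phi> (Or (conj_lits \<sigma>1) (conj_lits \<sigma>2)))
            (Imp (Neg (lit_formula l)) (chain_formula kernel_k V)))
            (Imp (lit_formula l) (chain_formula kernel_k V))"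
proof -
  let ?L = "Map.graph \<sigma>1 - Map.graph \<sigma>2 \<union> (Map.graph \<sigma>2 - Map.graph \<sigma>1)"
  have "finite ?L" using assms by (simp add: finite_graph_iff_finite_dom)
  \<comment> \<open>The support of \<open>pmf_of_set\<close> is known only for finite nonempty sets,
    so a literal on which the two assignments differ is required.\<close>
  moreover have "?L \<noteq> {}"
  proof
    assume "?L = {}"
    then have "Map.graph \<sigma>1 = Map.graph \<sigma>2" by blast
    then have "\<sigma>1 x = Some y \<longleftrightarrow> \<sigma>2 x = Some y" for x y
      by (simp add: Map.graph_def set_eq_iff)
    then have "\<sigma>1 = \<sigma>2" by (intro ext) (metis not_None_eq)
    then show False using assms by simp
  qed
  moreover have "fst l \<in> S" if "l \<in> ?L" for l
    using that assms by (auto simp: Map.graph_def dom_def)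
  ultimately show ?thesis
    using assms(5) that by (auto simp: barbarik2_kernel_def Let_def)
qed

text \<open>The implications from \<open>l\<close> and from its negation together assert the chain
  formula, whatever \<open>l\<close> is. Its variables are fresh and it is satisfiable, so it
  imposes no constraint on \<open>S\<close>.\<close>

lemma kernel_models:
  assumes S: "S \<subseteq> Supp \<phi>" and V: "fresh_vars V \<phi>"
    and \<sigma>: "\<sigma>1 \<in> proj_models \<phi> S" "\<sigma>2 \<in> proj_models \<phi> S" "\<sigma>1 \<noteq> \<sigma>2"
    and \<phi>': "\<phi>' \<in> set_pmf (barbarik2_kernel V \<phi> \<sigma>1 \<sigma>2)"
  shows "S \<subseteq> Supp \<phi>'" and "models \<phi>' \<noteq> {}" and "proj_models \<phi>' S = {\<sigma>1, \<sigma>2}"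
proof -
  let ?\<psi> = "chain_formula kernel_k V"
  have finS: "finite S" using S finite_Supp by (rule finite_subset)
  have dom: "dom \<sigma>1 = S" "dom \<sigma>2 = S" using dom_proj_models[OF S] \<sigma> by auto
  obtain l where l: "fst l \<in> S" and eq: "\<phi>' = And (And (And \<phi> (Or (conj_lits \<sigma>1) (conj_lits \<sigma>2)))
            (Imp (Neg (lit_formula l)) ?\<psi>)) (Imp (lit_formula l) ?\<psi>)"
    using set_pmf_barbarik2_kernel[OF finS dom \<sigma>(3) \<phi>'] by blast
  have Supp: "Supp \<phi>' = Supp \<phi> \<union> Supp ?\<psi>"
  proof -
    have "Supp (lit_formula l) \<subseteq> S" using l by (cases l) auto
    then show ?thesis using S dom finS by (auto simp: eq Supp_conj_lits)
  qed
  have disj: "set V \<inter> Supp \<phi> = {}" and len: "length V = 12"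
    using V by (auto simp: fresh_vars_def)
  have sat_iff: "sat \<rho> \<phi>' \<longleftrightarrow> sat \<rho> \<phi> \<and> (\<rho> |` S = \<sigma>1 \<or> \<rho> |` S = \<sigma>2) \<and> sat \<rho> ?\<psi>"
    if "S \<subseteq> dom \<rho>" for \<rho>
    using that dom finS by (auto simp: eq sat_conj_lits)
  show S': "S \<subseteq> Supp \<phi>'" using S by (auto simp: Supp)
  have mem: "\<tau> \<in> proj_models \<phi>' S" if \<tau>: "\<tau> \<in> proj_models \<phi> S" "\<tau> = \<sigma>1 \<or> \<tau> = \<sigma>2" for \<tau>
  proof -
    obtain m where m: "m \<in> models \<phi>" "\<tau> = m |` S" using \<tau> by (auto simp: proj_models_def)
    \<comment> \<open>Extend a model of \<open>\<phi>\<close> by making the variables of the chain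
      formula true; freshness leaves it unchanged on \<open>Supp \<phi>\<close>.\<close>
    define \<rho> where "\<rho> = (\<lambda>x. if x \<in> Supp ?\<psi> then Some True else m x)"
    have disj': "Supp ?\<psi> \<inter> Supp \<phi> = {}" using disj Supp_chain_formula by blast
    have "\<rho> x = m x" if "x \<in> Supp \<phi>" for x
      using that disj' by (auto simp: \<rho>_def)
    note m_eq = this
    have "sat \<rho> \<phi>" using m m_eq sat_cong[of \<phi> \<rho> m] by (auto simp: models_def)
    moreover have dom\<rho>: "dom \<rho> = Supp \<phi>'"
      using m by (auto simp: \<rho>_def Supp models_def dom_def)
    moreover have res: "\<rho> |` S = \<tau>"
      using m m_eq S by (auto simp: restrict_map_def fun_eq_iff)
    moreover have "sat \<rho> ?\<psi>"
    proof -
      have "sat (\<lambda>x. Some True) ?\<psi>"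
        by (rule sat_chain_formula) (auto simp: len)
      then show ?thesis by (subst sat_cong[of _ _ "\<lambda>x. Some True"]) (auto simp: \<rho>_def)
    qed
    ultimately have "\<rho> \<in> models \<phi>'"
      using \<tau>(2) S' by (auto simp: models_def sat_iff)
    then show ?thesis using res by (auto simp: proj_models_def)
  qed
  then show "models \<phi>' \<noteq> {}" using \<sigma> by (auto simp: proj_models_def)
  show "proj_models \<phi>' S = {\<sigma>1, \<sigma>2}"
  proof
    show "proj_models \<phi>' S \<subseteq> {\<sigma>1, \<sigma>2}"
      using S' by (auto simp: proj_models_def models_def sat_iff)
  qed (use mem \<sigma> in auto)
qed

subsection \<open>The tester as a sequence of independent rounds\<close>

lemma pmf_bind_ge:
  assumes "\<And>y. y \<in> set_pmf M \<Longrightarrow> b \<le> pmf (f y) x"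
  shows "b \<le> pmf (bind_pmf M f) x"
  unfolding pmf_bind using assms
  by (intro measure_pmf.integral_ge_const measure_pmf.integrable_const_bound[where B = 1])
    (auto simp: AE_measure_pmf_iff pmf_le_1)

lemma pmf_bind_le:
  assumes "\<And>y. y \<in> set_pmf M \<Longrightarrow> pmf (f y) x \<le> b"
  shows "pmf (bind_pmf M f) x \<le> b"
  unfolding pmf_bind using assms
  by (intro measure_pmf.integral_le_const measure_pmf.integrable_const_bound[where B = 1])
    (auto simp: AE_measure_pmf_iff pmf_le_1)

lemma pmf_bool_True: "pmf R True = 1 - pmf R False"
  using sum_pmf_eq_1[OF finite subset_UNIV, of R] by (simp add: UNIV_bool)

lemma map_pmf_count_replicate_pmf:
  "map_pmf (\<lambda>xs. length (filter P xs)) (replicate_pmf n M) =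
   binomial_pmf n (measure_pmf.prob M {x. P x})"
proof (induction n)
  case 0
  then show ?case by (simp add: binomial_pmf_0)
next
  case (Suc n)
  let ?p = "measure_pmf.prob M {x. P x}"
  have bern: "bernoulli_pmf ?p = map_pmf P M"
  proof (rule pmf_eqI)
    fix b
    have "measure_pmf.prob M {x. \<not> P x} = 1 - ?p"
      using measure_pmf.prob_compl[of "{x. P x}" M] by (simp add: set_diff_eq)
    then show "pmf (bernoulli_pmf ?p) b = pmf (map_pmf P M) b"
      by (cases b) (simp_all add: pmf_map vimage_def)
  qed
  have "map_pmf (\<lambda>xs. length (filter P xs)) (replicate_pmf (Suc n) M) =
      M \<bind> (\<lambda>x. map_pmf (\<lambda>xs. length (filter P xs)) (replicate_pmf n M) \<bind>
        (\<lambda>k. return_pmf ((if P x then 1 else 0) + k)))"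
    by (simp add: map_bind_pmf bind_map_pmf) (auto intro!: bind_pmf_cong)
  also have "\<dots> = binomial_pmf (Suc n) ?p"
    unfolding Suc by (subst binomial_pmf_Suc) (auto simp: bern bind_map_pmf)
  finally show ?case .
qed

text \<open>The tail of the first list and the head of the second are independent, so their draws
  can be exchanged. The loop thus runs on independent, identically distributed pairs.\<close>

lemma bind_replicate_pmf_zip:
  "replicate_pmf n P \<bind> (\<lambda>xs. replicate_pmf n Q \<bind> (\<lambda>ys. f (zip xs ys))) =
   replicate_pmf n (pair_pmf P Q) \<bind> f"
proof (induction n arbitrary: f)
  case (Suc n)
  have "replicate_pmf (Suc n) P \<bind> (\<lambda>xs. replicate_pmf (Suc n) Q \<bind> (\<lambda>ys. f (zip xs ys))) =
    P \<bind> (\<lambda>x. replicate_pmf n P \<bind> (\<lambda>xs. Q \<bind> (\<lambda>y. replicate_pmf n Q \<bind>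
      (\<lambda>ys. f ((x, y) # zip xs ys)))))"
    by (simp add: bind_assoc_pmf bind_return_pmf)
  also have "\<dots> = P \<bind> (\<lambda>x. Q \<bind> (\<lambda>y. replicate_pmf n P \<bind> (\<lambda>xs. replicate_pmf n Q \<bind>
      (\<lambda>ys. f ((x, y) # zip xs ys)))))"
    by (subst (2) bind_commute_pmf) (rule refl)
  also have "\<dots> = replicate_pmf (Suc n) (pair_pmf P Q) \<bind> f"
    by (subst Suc) (simp add: bind_assoc_pmf bind_return_pmf pair_pmf_def)
  finally show ?case .
qed (simp add: bind_return_pmf)

text \<open>Odds \<open>r\<close> correspond to the probability \<open>r / (1 + r)\<close>: this is
  the share of \<open>\<sigma>1\<close> in the pair when its odds are
  \<open>test_lo \<epsilon>\<close> times the ideal odds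
  \<open>wt \<sigma>1 / wt \<sigma>2\<close>.\<close>

definition test_L :: "weight \<Rightarrow> real \<Rightarrow> assignment \<Rightarrow> assignment \<Rightarrow> real" where
  "test_L wt \<epsilon> \<sigma>1 \<sigma>2 =
     wt \<sigma>1 / wt \<sigma>2 * test_lo \<epsilon> / (1 + wt \<sigma>1 / wt \<sigma>2 * test_lo \<epsilon>)"

definition test_H :: "weight \<Rightarrow> real \<Rightarrow> real \<Rightarrow> assignment \<Rightarrow> assignment \<Rightarrow> real" where
  "test_H wt \<epsilon> \<eta> \<sigma>1 \<sigma>2 =
     wt \<sigma>1 / wt \<sigma>2 * test_hi \<epsilon> \<eta> / (1 + wt \<sigma>1 / wt \<sigma>2 * test_hi \<epsilon> \<eta>)"

definition test_T :: "weight \<Rightarrow> real \<Rightarrow> real \<Rightarrow> assignment \<Rightarrow> assignment \<Rightarrow> real" where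
  "test_T wt \<epsilon> \<eta> \<sigma>1 \<sigma>2 = (test_H wt \<epsilon> \<eta> \<sigma>1 \<sigma>2 + test_L wt \<epsilon> \<sigma>1 \<sigma>2) / 2"

definition test_N :: "weight \<Rightarrow> real \<Rightarrow> real \<Rightarrow> real \<Rightarrow> assignment \<Rightarrow> assignment \<Rightarrow> nat" where
  "test_N wt \<epsilon> \<eta> \<delta> \<sigma>1 \<sigma>2 =
     nat \<lceil>test_n \<epsilon> \<eta> \<delta> * test_H wt \<epsilon> \<eta> \<sigma>1 \<sigma>2 /
       (test_H wt \<epsilon> \<eta> \<sigma>1 \<sigma>2 - test_L wt \<epsilon> \<sigma>1 \<sigma>2)\<^sup>2\<rceil>"

text \<open>One iteration of the tester; the outcome \<open>True\<close> means rejection.\<close>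

definition test_round ::
  "sampler \<Rightarrow> real \<Rightarrow> real \<Rightarrow> real \<Rightarrow> formula \<Rightarrow> nat set \<Rightarrow> weight \<Rightarrow> nat list \<Rightarrow>
   assignment \<times> assignment \<Rightarrow> bool pmf" where
  "test_round G \<epsilon> \<eta> \<delta> \<phi> S wt V = (\<lambda>(\<sigma>1, \<sigma>2).
     if \<sigma>1 = \<sigma>2 then return_pmf False
     else do {
       \<phi>' \<leftarrow> barbarik2_kernel V \<phi> \<sigma>1 \<sigma>2;
       \<Gamma> \<leftarrow> replicate_pmf (test_N wt \<epsilon> \<eta> \<delta> \<sigma>1 \<sigma>2) (G \<phi>' S wt);
       return_pmf (real (length (filter (\<lambda>\<sigma>. \<sigma> |` S = \<sigma>1) \<Gamma>)) /
         real (test_N wt \<epsilon> \<eta> \<delta> \<sigma>1 \<sigma>2) > test_T wt \<epsilon> \<eta> \<sigma>1 \<sigma>2)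
     })"

lemma barbarik2_loop_Cons:
  "barbarik2_loop G \<epsilon> \<eta> \<delta> \<phi> S wt V ((\<sigma>1, \<sigma>2) # ps) c =
   (let c' = (if \<sigma>1 = \<sigma>2 then c else c + test_N wt \<epsilon> \<eta> \<delta> \<sigma>1 \<sigma>2)
    in test_round G \<epsilon> \<eta> \<delta> \<phi> S wt V (\<sigma>1, \<sigma>2) \<bind> (\<lambda>rej.
      if rej then return_pmf (REJECT, c') else barbarik2_loop G \<epsilon> \<eta> \<delta> \<phi> S wt V ps c'))"
  unfolding barbarik2_loop.simps Let_def fst_conv snd_conv test_L_def[symmetric] test_H_def[symmetric]
    test_T_def[symmetric] test_N_def[symmetric]
  by (simp add: test_round_def bind_return_pmf bind_assoc_pmf)

text \<open>Acceptance means that no round rejects, and on a fixed list of pairs the rounds use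
  separate samples. The counter does not influence the verdict, so \<open>c\<close> is
  arbitrary.\<close>

lemma pmf_fst_barbarik2_loop:
  "pmf (map_pmf fst (barbarik2_loop G \<epsilon> \<eta> \<delta> \<phi> S wt V ps c)) ACCEPT =
   prod_list (map (\<lambda>p. pmf (test_round G \<epsilon> \<eta> \<delta> \<phi> S wt V p) False) ps)"
proof (induction ps arbitrary: c)
  case (Cons p ps)
  obtain \<sigma>1 \<sigma>2 where p: "p = (\<sigma>1, \<sigma>2)" by (cases p)
  let ?R = "test_round G \<epsilon> \<eta> \<delta> \<phi> S wt V p"
  define c' where "c' = (if \<sigma>1 = \<sigma>2 then c else c + test_N wt \<epsilon> \<eta> \<delta> \<sigma>1 \<sigma>2)"
  have "map_pmf fst (barbarik2_loop G \<epsilon> \<eta> \<delta> \<phi> S wt V (p # ps) c) =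
    ?R \<bind> (\<lambda>rej. if rej then return_pmf REJECT
      else map_pmf fst (barbarik2_loop G \<epsilon> \<eta> \<delta> \<phi> S wt V ps c'))"
    unfolding p barbarik2_loop_Cons Let_def c'_def[symmetric] map_bind_pmf
    by (intro bind_pmf_cong) auto
  moreover have "pmf (?R \<bind> (\<lambda>rej. if rej then return_pmf REJECT
      else map_pmf fst (barbarik2_loop G \<epsilon> \<eta> \<delta> \<phi> S wt V ps c'))) ACCEPT =
    (\<Sum>b\<in>UNIV. pmf (if b then return_pmf REJECT
      else map_pmf fst (barbarik2_loop G \<epsilon> \<eta> \<delta> \<phi> S wt V ps c')) ACCEPT * pmf ?R b)"
    unfolding pmf_bind by (rule integral_measure_pmf_real) auto
  ultimately show ?case
    using Cons by (simp add: UNIV_bool mult.commute)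
qed simp

lemma prob_barbarik2_ACCEPT:
  "measure_pmf.prob (barbarik2 G A \<epsilon> \<eta> \<delta> \<phi> S wt V) {(v, c). v = ACCEPT} =
   measure_pmf.expectation (pair_pmf (G \<phi> S wt) (A \<phi> S wt))
     (\<lambda>p. pmf (test_round G \<epsilon> \<eta> \<delta> \<phi> S wt V p) False) ^ num_iterations \<epsilon> \<eta> \<delta>"
proof -
  let ?t = "num_iterations \<epsilon> \<eta> \<delta>"
  let ?Q = "pair_pmf (G \<phi> S wt) (A \<phi> S wt)"
  let ?f = "\<lambda>p. pmf (test_round G \<epsilon> \<eta> \<delta> \<phi> S wt V p) False"
  let ?loop = "\<lambda>ps. map_pmf fst (barbarik2_loop G \<epsilon> \<eta> \<delta> \<phi> S wt V ps (2 * ?t))"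
  \<comment> \<open>The number \<open>n\<close> of pairs is generalised for the induction, while the
    initial counter inside \<open>?loop\<close> stays at \<open>2 * ?t\<close>.\<close>
  have "pmf (replicate_pmf n ?Q \<bind> ?loop) ACCEPT = measure_pmf.expectation ?Q ?f ^ n" for n
  proof (induction n)
    case (Suc n)
    have "pmf (replicate_pmf (Suc n) ?Q \<bind> ?loop) ACCEPT =
        pmf (?Q \<bind> (\<lambda>p. replicate_pmf n ?Q \<bind> (\<lambda>ps. ?loop (p # ps)))) ACCEPT"
      by (simp only: replicate_pmf.simps bind_assoc_pmf bind_return_pmf)
    also have "\<dots> = measure_pmf.expectation ?Q
        (\<lambda>p. measure_pmf.expectation (replicate_pmf n ?Q) (\<lambda>ps. ?f p * pmf (?loop ps) ACCEPT))"
      by (simp only: pmf_bind pmf_fst_barbarik2_loop list.map prod_list.Cons)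
    also have "\<dots> = measure_pmf.expectation ?Q (\<lambda>p. ?f p * pmf (replicate_pmf n ?Q \<bind> ?loop) ACCEPT)"
      by (simp only: integral_mult_right_zero pmf_bind)
    also have "\<dots> = measure_pmf.expectation ?Q ?f ^ Suc n"
      by (simp only: integral_mult_left_zero Suc power_Suc)
    finally show ?case .
  qed (simp add: bind_return_pmf)
  moreover have "map_pmf fst (barbarik2 G A \<epsilon> \<eta> \<delta> \<phi> S wt V) = replicate_pmf ?t ?Q \<bind> ?loop"
    by (simp add: barbarik2_def Let_def map_bind_pmf flip: bind_replicate_pmf_zip)
  moreover have "{(v, c :: nat). v = ACCEPT} = fst -` {ACCEPT}" by auto
  ultimately show ?thesis
    by (metis pmf_map)
qed

lemma prob_barbarik2_REJECT:
  "measure_pmf.prob (barbarik2 G A \<epsilon> \<eta> \<delta> \<phi> S wt V) {(v, c). v = REJECT} =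
   1 - measure_pmf.prob (barbarik2 G A \<epsilon> \<eta> \<delta> \<phi> S wt V) {(v, c). v = ACCEPT}"
proof -
  have "{(v, c). v = REJECT} = UNIV - {(v :: verdict, c :: nat). v = ACCEPT}"
    by (auto intro: verdict.exhaust)
  then show ?thesis
    using measure_pmf.prob_compl[of "{(v, c). v = ACCEPT}" "barbarik2 G A \<epsilon> \<eta> \<delta> \<phi> S wt V"] by simp
qed

lemma pmf_test_round_cases:
  fixes G \<epsilon> \<eta> \<delta> \<phi> S wt V \<sigma>1 \<sigma>2
  defines "tail \<phi>' \<equiv> measure_pmf.prob
      (binomial_pmf (test_N wt \<epsilon> \<eta> \<delta> \<sigma>1 \<sigma>2) (measure_pmf.prob (G \<phi>' S wt) {\<sigma>. \<sigma> |` S = \<sigma>1}))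
      {k. real k > real (test_N wt \<epsilon> \<eta> \<delta> \<sigma>1 \<sigma>2) * test_T wt \<epsilon> \<eta> \<sigma>1 \<sigma>2}"
  assumes ne: "\<sigma>1 \<noteq> \<sigma>2" and N: "test_N wt \<epsilon> \<eta> \<delta> \<sigma>1 \<sigma>2 > 0"
  shows "(\<And>\<phi>'. \<phi>' \<in> set_pmf (barbarik2_kernel V \<phi> \<sigma>1 \<sigma>2) \<Longrightarrow> b \<le> tail \<phi>') \<Longrightarrow>
      b \<le> pmf (test_round G \<epsilon> \<eta> \<delta> \<phi> S wt V (\<sigma>1, \<sigma>2)) True"
    and "(\<And>\<phi>'. \<phi>' \<in> set_pmf (barbarik2_kernel V \<phi> \<sigma>1 \<sigma>2) \<Longrightarrow> tail \<phi>' \<le> b) \<Longrightarrow>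
      pmf (test_round G \<epsilon> \<eta> \<delta> \<phi> S wt V (\<sigma>1, \<sigma>2)) True \<le> b"
proof -
  let ?N = "test_N wt \<epsilon> \<eta> \<delta> \<sigma>1 \<sigma>2"
  let ?T = "test_T wt \<epsilon> \<eta> \<sigma>1 \<sigma>2"
  let ?f = "\<lambda>\<phi>'. map_pmf (\<lambda>k. real k / real ?N > ?T)
      (map_pmf (\<lambda>xs. length (filter (\<lambda>\<sigma>. \<sigma> |` S = \<sigma>1) xs)) (replicate_pmf ?N (G \<phi>' S wt)))"
  have round: "test_round G \<epsilon> \<eta> \<delta> \<phi> S wt V (\<sigma>1, \<sigma>2) = barbarik2_kernel V \<phi> \<sigma>1 \<sigma>2 \<bind> ?f"
    using ne by (simp add: test_round_def map_pmf_def bind_assoc_pmf bind_return_pmf)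
  \<comment> \<open>As \<open>?N\<close> is positive, the comparison of the bias with
    \<open>?T\<close> can be multiplied out to one of counts; for \<open>?N = 0\<close> the quotient
    would be 0 by convention.\<close>
  have f: "pmf (?f \<phi>') True = tail \<phi>'" for \<phi>'
    unfolding map_pmf_count_replicate_pmf pmf_map tail_def using N
    by (intro arg_cong[where f = "measure_pmf.prob _"]) (auto simp: field_simps)
  show "b \<le> pmf (test_round G \<epsilon> \<eta> \<delta> \<phi> S wt V (\<sigma>1, \<sigma>2)) True"
    if "\<And>\<phi>'. \<phi>' \<in> set_pmf (barbarik2_kernel V \<phi> \<sigma>1 \<sigma>2) \<Longrightarrow> b \<le> tail \<phi>'"
    unfolding round by (rule pmf_bind_ge) (simp only: f that)
  show "pmf (test_round G \<epsilon> \<eta> \<delta> \<phi> S wt V (\<sigma>1, \<sigma>2)) True \<le> b"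
    if "\<And>\<phi>'. \<phi>' \<in> set_pmf (barbarik2_kernel V \<phi> \<sigma>1 \<sigma>2) \<Longrightarrow> tail \<phi>' \<le> b"
    unfolding round by (rule pmf_bind_le) (simp only: f that)
qed

text \<open>The pairs cost two samples per iteration and each round at most \<open>B\<close> more.
  The bound holds on every run; \<open>0 \<le> B\<close> covers rounds that are skipped or cut off
  by a rejection.\<close>

lemma barbarik2_samples:
  assumes "(v, c) \<in> set_pmf (barbarik2 G A \<epsilon> \<eta> \<delta> \<phi> S wt V)"
    and "\<And>\<sigma>1 \<sigma>2. \<sigma>1 \<in> set_pmf (G \<phi> S wt) \<Longrightarrow> \<sigma>2 \<in> set_pmf (A \<phi> S wt) \<Longrightarrow>
           real (test_N wt \<epsilon> \<eta> \<delta> \<sigma>1 \<sigma>2) \<le> B"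
    and "0 \<le> B"
  shows "real c \<le> real (num_iterations \<epsilon> \<eta> \<delta>) * (2 + B)"
proof -
  have loop: "real c \<le> real c0 + real (length ps) * B"
    if "(v, c) \<in> set_pmf (barbarik2_loop G \<epsilon> \<eta> \<delta> \<phi> S wt V ps c0)"
      "set ps \<subseteq> set_pmf (G \<phi> S wt) \<times> set_pmf (A \<phi> S wt)" for ps c0
    using that
  proof (induction ps arbitrary: c0)
    case (Cons p ps)
    obtain \<sigma>1 \<sigma>2 where p: "p = (\<sigma>1, \<sigma>2)" by (cases p)
    define c' where "c' = (if \<sigma>1 = \<sigma>2 then c0 else c0 + test_N wt \<epsilon> \<eta> \<delta> \<sigma>1 \<sigma>2)"
    have c': "real c' \<le> real c0 + B"
      using assms(2)[of \<sigma>1 \<sigma>2] Cons.prems(2) assms(3) by (auto simp: c'_def p)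
    have "c = c' \<or> (v, c) \<in> set_pmf (barbarik2_loop G \<epsilon> \<eta> \<delta> \<phi> S wt V ps c')"
      using Cons.prems(1) unfolding p barbarik2_loop_Cons Let_def c'_def[symmetric]
      by (auto split: if_splits)
    then have "real c \<le> real c' + real (length ps) * B"
      using Cons.IH[of c'] Cons.prems(2) assms(3) by auto
    with c' show ?case by (simp add: algebra_simps)
  qed auto
  from assms(1) obtain xs ys where
    "xs \<in> set_pmf (replicate_pmf (num_iterations \<epsilon> \<eta> \<delta>) (G \<phi> S wt))"
    "ys \<in> set_pmf (replicate_pmf (num_iterations \<epsilon> \<eta> \<delta>) (A \<phi> S wt))"
    "(v, c) \<in> set_pmf (barbarik2_loop G \<epsilon> \<eta> \<delta> \<phi> S wt V (zip xs ys) (2 * num_iterations \<epsilon> \<eta> \<delta>))"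
    by (auto simp: barbarik2_def Let_def)
  moreover from this have "set (zip xs ys) \<subseteq> set_pmf (G \<phi> S wt) \<times> set_pmf (A \<phi> S wt)"
    by (auto simp: set_replicate_pmf dest: set_zip_leftD set_zip_rightD)
  ultimately show ?thesis
    using loop[of "zip xs ys" "2 * num_iterations \<epsilon> \<eta> \<delta>"]
    by (simp add: set_replicate_pmf algebra_simps)
qed

subsection \<open>The probability of a bad pair\<close>

text \<open>
  Fix \<open>x\<close> with \<open>a x < g x\<close>. As \<open>\<tau> \<le> (\<Sum>y. max 0 (a y - g y))\<close> and a summand is at most \<open>a y\<close> if
  \<open>(1 + h) * (g y / a y) \<le> g x / a x\<close>, and at most \<open>(1 - g x / ((1 + h) * a x)) * a y\<close> otherwise, the
  \<open>a\<close>-mass of the partners of \<open>x\<close> is bounded below by an affine function of \<open>g x / a x\<close>, which is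
  then averaged over \<open>x\<close>.
\<close>

lemma bad_pair_probability:
  fixes a g :: "'a \<Rightarrow> real"
  assumes fin: "finite P" and a: "\<And>x. x \<in> P \<Longrightarrow> 0 < a x" and g: "\<And>x. x \<in> P \<Longrightarrow> 0 \<le> g x"
    and sum_a: "sum a P = 1" and sum_g: "sum g P = 1"
    and far: "2 * \<tau> \<le> (\<Sum>x\<in>P. \<bar>a x - g x\<bar>)" and h: "0 \<le> h" "h \<le> \<tau>"
  shows "\<tau> \<le> 1"
    and "\<tau> * (1 - (1 - \<tau>)\<^sup>2 / 4) \<le>
      (\<Sum>x\<in>{x\<in>P. a x < g x}. \<Sum>y\<in>{y\<in>P. (1 + h) * g y * a x \<le> g x * a y}. g x * a y)"
proof -
  define X where "X = {x\<in>P. a x < g x}"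
  define Y where "Y = {x\<in>P. g x \<le> a x}"
  have XY: "P = X \<union> Y" "X \<inter> Y = {}" "finite X" "finite Y"
    using fin by (auto simp: X_def Y_def)
  define u v where "u = sum a Y" and "v = sum a X"
  have uv: "v + u = 1"
    using sum_a XY by (simp add: u_def v_def sum.union_disjoint)
  have gXY: "sum g X + sum g Y = 1"
    using sum_g XY by (simp add: sum.union_disjoint)
  have v0: "0 \<le> v" and u0: "0 \<le> u"
    using a by (auto simp: u_def v_def X_def Y_def less_imp_le intro: sum_nonneg)
  have "(\<Sum>x\<in>P. \<bar>a x - g x\<bar>) = (\<Sum>x\<in>X. g x - a x) + (\<Sum>x\<in>Y. a x - g x)"
    using XY by (simp add: sum.union_disjoint) (auto simp: X_def Y_def intro!: arg_cong2[where f = "(+)"] sum.cong)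
  also have "\<dots> = (sum g X - v) + (u - sum g Y)"
    by (simp add: u_def v_def sum_subtractf)
  \<comment> \<open>As \<open>a\<close> and \<open>g\<close> have equal mass, the excess of
    \<open>g\<close> on \<open>X\<close> equals its deficit on \<open>Y\<close>, so each is half of
    the distance.\<close>
  finally have \<tau>Y: "\<tau> \<le> u - sum g Y" and \<tau>X: "\<tau> \<le> sum g X - v"
    using far uv gXY by linarith+
  have "0 \<le> sum g Y" using g by (auto simp: Y_def intro!: sum_nonneg)
  then have \<tau>u: "\<tau> \<le> u" using \<tau>Y by linarith
  then show "\<tau> \<le> 1" using uv v0 by linarith
  have x_bound: "a x * ((1 + h) * (\<tau> - u)) + u * g x \<le>
      (\<Sum>y\<in>{y\<in>P. (1 + h) * g y * a x \<le> g x * a y}. g x * a y)" if x: "x \<in> X" for x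
  proof -
    let ?Z = "{y\<in>P. (1 + h) * g y * a x \<le> g x * a y}"
    have ax: "0 < a x" "a x < g x" using x a by (auto simp: X_def)
    have Z: "finite ?Z" using fin by simp
    show ?thesis
    proof (cases "(1 + h) * a x \<le> g x")
      case True
      have "Y \<subseteq> ?Z"
      proof
        fix y assume y: "y \<in> Y"
        have "(1 + h) * g y * a x = g y * ((1 + h) * a x)" by simp
        also have "\<dots> \<le> a y * g x"
          using y True g h ax a by (intro mult_mono) (auto simp: Y_def less_imp_le)
        finally show "y \<in> ?Z" using y by (simp add: Y_def mult.commute)
      qed
      then have "u \<le> sum a ?Z"
        unfolding u_def using Z a by (intro sum_mono2) (auto simp: less_imp_le)
      then have "u * g x \<le> (\<Sum>y\<in>?Z. g x * a y)"
        using ax mult_right_mono[of u "sum a ?Z" "g x"] by (simp add: sum_distrib_left mult.commute)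
      moreover have "a x * ((1 + h) * (\<tau> - u)) \<le> 0"
        using ax h \<tau>u by (intro mult_nonneg_nonpos) auto
      ultimately show ?thesis by linarith
    next
      case False
      \<comment> \<open>The critical ratio: \<open>y\<close> is a partner of \<open>x\<close>
        exactly if \<open>g y \<le> q * a y\<close>.\<close>
      define q where "q = g x / ((1 + h) * a x)"
      have hx: "(1 + h) * a x > 0" using h ax by simp
      have q: "0 < q" "q < 1" using False ax hx by (auto simp: q_def)
      have gx: "g x = q * ((1 + h) * a x)" using h ax by (auto simp: q_def)
      have Z_iff: "y \<in> ?Z \<longleftrightarrow> g y \<le> q * a y" if "y \<in> P" for y
      proof -
        have "g x * a y = q * a y * ((1 + h) * a x)"
          unfolding gx by (simp only: mult_ac)
        moreover have "(1 + h) * g y * a x = g y * ((1 + h) * a x)"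
          by (simp only: mult_ac)
        ultimately show ?thesis
          using that mult_le_cancel_right_pos[OF hx, of "g y" "q * a y"] by (simp only: mem_Collect_eq simp_thms)
      qed
      have "\<tau> \<le> (\<Sum>y\<in>Y. a y - g y)" using \<tau>Y by (simp add: u_def sum_subtractf)
      also have "\<dots> \<le> (\<Sum>y\<in>Y. (1 - q) * a y + (if y \<in> ?Z then q * a y else 0))"
      proof (rule sum_mono)
        fix y assume "y \<in> Y"
        then have "y \<in> P" by (simp add: Y_def)
        then show "a y - g y \<le> (1 - q) * a y + (if y \<in> ?Z then q * a y else 0)"
          using Z_iff[of y] g[of y] by (auto simp: algebra_simps)
      qed
      also have "\<dots> \<le> (1 - q) * u + q * sum a ?Z"
      proof -
        have "(\<Sum>y\<in>Y. if y \<in> ?Z then q * a y else 0) = (\<Sum>y\<in>Y \<inter> ?Z. q * a y)"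
          using XY(4) by (simp add: sum.inter_restrict)
        also have "\<dots> \<le> (\<Sum>y\<in>?Z. q * a y)"
          using Z a q by (intro sum_mono2) (auto simp: less_imp_le)
        finally show ?thesis by (simp add: sum.distrib sum_distrib_left u_def)
      qed
      finally have "(1 + h) * a x * \<tau> \<le> (1 + h) * a x * ((1 - q) * u + q * sum a ?Z)"
        using hx by (intro mult_left_mono) auto
      then have "a x * ((1 + h) * (\<tau> - u)) + u * g x \<le> g x * sum a ?Z"
        unfolding gx by (simp add: algebra_simps)
      then show ?thesis by (simp add: sum_distrib_left)
    qed
  qed
  have "\<tau> * (1 - (1 - \<tau>)\<^sup>2 / 4) \<le> \<tau> - \<tau> * (v * (u - \<tau>))"
  proof -
    \<comment> \<open>Arithmetic-geometric mean: the factors \<open>v\<close> and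
      \<open>u - \<tau>\<close> add up to \<open>1 - \<tau>\<close>.\<close>
    have "v * (u - \<tau>) \<le> (1 - \<tau>)\<^sup>2 / 4"
    proof -
      have u: "u - \<tau> = (1 - \<tau>) - v" using uv by simp
      have "(1 - \<tau>)\<^sup>2 / 4 - v * (u - \<tau>) = ((1 - \<tau>) / 2 - v)\<^sup>2"
        unfolding u by (simp add: field_simps power2_eq_square)
      then show ?thesis using zero_le_power2[of "(1 - \<tau>) / 2 - v"] by linarith
    qed
    then have "\<tau> * (v * (u - \<tau>)) \<le> \<tau> * ((1 - \<tau>)\<^sup>2 / 4)" using h by (intro mult_left_mono) auto
    then show ?thesis by (simp add: algebra_simps)
  qed
  also have "\<dots> \<le> \<tau> - h * (v * (u - \<tau>))"
    using h v0 \<tau>u mult_right_mono[of h \<tau> "v * (u - \<tau>)"] by simp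
  also have "\<dots> = v * ((1 + h) * (\<tau> - u)) + u * (v + \<tau>)"
  proof -
    have u: "u = 1 - v" using uv by simp
    show ?thesis unfolding u by (simp add: algebra_simps)
  qed
  also have "\<dots> \<le> v * ((1 + h) * (\<tau> - u)) + u * sum g X"
    using \<tau>X u0 by (intro add_left_mono mult_left_mono) auto
  also have "\<dots> = (\<Sum>x\<in>X. a x * ((1 + h) * (\<tau> - u)) + u * g x)"
    by (simp add: v_def sum.distrib sum_distrib_left sum_distrib_right)
  also have "\<dots> \<le> (\<Sum>x\<in>X. \<Sum>y\<in>{y\<in>P. (1 + h) * g y * a x \<le> g x * a y}. g x * a y)"
    by (rule sum_mono) (rule x_bound)
  finally show "\<tau> * (1 - (1 - \<tau>)\<^sup>2 / 4) \<le>
      (\<Sum>x\<in>{x\<in>P. a x < g x}. \<Sum>y\<in>{y\<in>P. (1 + h) * g y * a x \<le> g x * a y}. g x * a y)"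
    by (simp only: X_def)
qed

subsection \<open>The parameters of the tester\<close>

text \<open>As \<open>\<eta> * (\<eta> - 6 * \<epsilon>)\<close> lies strictly between 0 and 10,
  \<open>num_iterations\<close> divides by a positive logarithm.\<close>

locale barbarik_params =
  fixes \<epsilon> \<eta> \<delta> :: real
  assumes eps: "0 \<le> \<epsilon>" "\<epsilon> < 1 / 3" and eta: "\<eta> > 6 * \<epsilon>" "\<eta> * (\<eta> - 6 * \<epsilon>) < 10"
    and delta: "0 < \<delta>" "\<delta> < 1"
begin

abbreviation "x \<equiv> \<eta> * (\<eta> - 6 * \<epsilon>)"
abbreviation "t \<equiv> num_iterations \<epsilon> \<eta> \<delta>"

lemma x_pos: "x > 0"
  using eps eta by simp

lemma lo_hi_bounds:
  shows "1 \<le> test_lo \<epsilon>" "test_lo \<epsilon> \<le> 2"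
    and "(\<eta> - 6 * \<epsilon>) / 4 \<le> test_hi \<epsilon> \<eta> - test_lo \<epsilon>" "test_hi \<epsilon> \<eta> - test_lo \<epsilon> \<le> \<eta> / 4"
    and "test_lo \<epsilon> < test_hi \<epsilon> \<eta>" "test_hi \<epsilon> \<eta> \<le> 3"
proof -
  have eq: "test_lo \<epsilon> = 1 + 2 * \<epsilon> / (1 - \<epsilon>)" using eps by (simp add: test_lo_def field_simps)
  have lower: "2 * \<epsilon> \<le> 2 * \<epsilon> / (1 - \<epsilon>)"
    using eps by (simp add: field_simps)
  \<comment> \<open>This is where \<open>\<epsilon> < 1 / 3\<close> enters; it makes the gap between
    \<open>test_lo\<close> and \<open>test_hi\<close> at least
    \<open>(\<eta> - 6 * \<epsilon>) / 4\<close>.\<close>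
  have upper: "2 * \<epsilon> / (1 - \<epsilon>) \<le> 3 * \<epsilon>"
  proof -
    have "0 \<le> \<epsilon> * (1 - 3 * \<epsilon>)" using eps by simp
    then show ?thesis using eps by (simp add: divide_le_eq algebra_simps)
  qed
  show 1: "1 \<le> test_lo \<epsilon>" "test_lo \<epsilon> \<le> 2"
    using lower upper eps by (auto simp: eq)
  show 2: "(\<eta> - 6 * \<epsilon>) / 4 \<le> test_hi \<epsilon> \<eta> - test_lo \<epsilon>"
  proof -
    define q where "q = 2 * \<epsilon> / (1 - \<epsilon>)"
    have "q \<le> 3 * \<epsilon>" using upper by (simp only: q_def)
    then show ?thesis unfolding eq test_hi_def q_def[symmetric] by (simp add: field_simps)
  qed
  show "test_hi \<epsilon> \<eta> - test_lo \<epsilon> \<le> \<eta> / 4"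
    using lower eps unfolding eq test_hi_def by (simp add: add_divide_distrib)
  show "test_lo \<epsilon> < test_hi \<epsilon> \<eta>"
  proof -
    have "0 < (\<eta> - 6 * \<epsilon>) / 4" using eta by simp
    also note 2
    finally show ?thesis by simp
  qed
  have "\<eta> < 5"
  proof (rule ccontr)
    assume "\<not> \<eta> < 5"
    then have "5 * 3 \<le> x" using eps by (intro mult_mono) auto
    then show False using eta by simp
  qed
  then show "test_hi \<epsilon> \<eta> \<le> 3" using eps by (simp add: test_hi_def)
qed

lemma ln_ratio: "x / 10 \<le> ln (10 / (10 - x))"
proof -
  have "ln (1 - x / 10) \<le> - (x / 10)"
    using ln_le_minus_one[of "1 - x / 10"] eta by simp
  moreover have "10 / (10 - x) = inverse (1 - x / 10)"
    using eta by (simp add: field_simps)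
  ultimately show ?thesis using eta by (simp add: ln_inverse)
qed

lemma num_iterations_pos: "t > 0"
proof -
  have "ln (1 / \<delta>) / ln (10 / (10 - x)) > 0"
    using delta ln_ratio x_pos by (intro divide_pos_pos) (auto simp: ln_div)
  then show ?thesis by (simp add: num_iterations_def)
qed

lemma num_iterations_upper: "real t \<le> 10 * (1 + ln (1 / \<delta>)) / x"
proof -
  let ?a = "ln (1 / \<delta>)"
  have a: "?a > 0" using delta by (simp add: ln_div)
  have l: "ln (10 / (10 - x)) > 0" using ln_ratio x_pos by linarith
  have "real t \<le> ?a / ln (10 / (10 - x)) + 1"
    using a l unfolding num_iterations_def by (simp add: of_nat_nat)
  \<comment> \<open>The 1 lost by rounding up is at most \<open>10 / x\<close>, since
    \<open>x < 10\<close>.\<close>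
  also have "\<dots> \<le> ?a / (x / 10) + 10 / x"
    using ln_ratio x_pos a l eta by (intro add_mono divide_left_mono) auto
  also have "\<dots> = 10 * (1 + ?a) / x"
    using add_divide_distrib[of 10 "10 * ?a" x] by (simp add: algebra_simps)
  finally show ?thesis .
qed

text \<open>The ratio \<open>10 / (10 - x)\<close> is the reciprocal of \<open>1 - x / 10\<close>,
  so \<open>t\<close> is chosen to push the power of the latter below \<open>\<delta>\<close>. Hence
  rejection with probability \<open>x / 10\<close> per round suffices.\<close>

lemma power_num_iterations:
  assumes "0 \<le> r" "r \<le> 1 - x / 10"
  shows "r ^ t \<le> \<delta>"
proof -
  let ?l = "ln (10 / (10 - x))"
  have l: "?l > 0" using ln_ratio x_pos by linarith
  have r: "1 - x / 10 = exp (- ?l)"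
    using eta by (simp add: ln_div exp_diff field_simps)
  have "r ^ t \<le> exp (- ?l) ^ t"
    using assms by (intro power_mono) (auto simp: r)
  also have "\<dots> = exp (- (real t * ?l))"
    by (simp add: exp_of_nat_mult[symmetric])
  also have "\<dots> \<le> exp (- ln (1 / \<delta>))"
  proof -
    have "ln (1 / \<delta>) / ?l \<le> real t"
      unfolding num_iterations_def by linarith
    then show ?thesis using l by (simp add: divide_le_eq)
  qed
  also have "\<dots> = \<delta>" using delta by (simp add: ln_div)
  finally show ?thesis .
qed

lemma test_n_pos: "test_n \<epsilon> \<eta> \<delta> > 0"
proof -
  have "1 < 1 / \<delta>" using delta by simp
  also have "\<dots> \<le> real t / \<delta>" using num_iterations_pos delta by (intro divide_right_mono) auto
  finally show ?thesis by (simp add: test_n_def)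
qed

text \<open>The 8 matches the Chernoff exponent: \<open>n * H / (H - L)^2\<close> samples at
  deviation \<open>(H - L) / 2\<close> yield \<open>n / 8\<close>, hence error at most
  \<open>\<delta> / real t\<close> per round.\<close>

lemma exp_test_n: "exp (- test_n \<epsilon> \<eta> \<delta> / 8) = \<delta> / real t"
  using num_iterations_pos delta by (simp add: test_n_def exp_minus)

lemma threshold_bounds:
  fixes wt :: weight
  assumes wt: "0 < wt \<sigma>1" "0 < wt \<sigma>2"
  defines "L \<equiv> test_L wt \<epsilon> \<sigma>1 \<sigma>2" and "H \<equiv> test_H wt \<epsilon> \<eta> \<sigma>1 \<sigma>2" and "T \<equiv> test_T wt \<epsilon> \<eta> \<sigma>1 \<sigma>2"
    and "N \<equiv> test_N wt \<epsilon> \<eta> \<delta> \<sigma>1 \<sigma>2"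
  shows "0 < L" "L < T" "T < H" "H < 1" "N > 0"
    and "T - L = (H - L) / 2" "H - T = (H - L) / 2"
    and "test_n \<epsilon> \<eta> \<delta> * H / (H - L)\<^sup>2 \<le> real N"
    and "real N \<le> test_n \<epsilon> \<eta> \<delta> * H / (H - L)\<^sup>2 + 1"
proof -
  define \<alpha> where "\<alpha> = wt \<sigma>1 / wt \<sigma>2"
  have \<alpha>: "\<alpha> > 0" using wt by (simp add: \<alpha>_def)
  define l h where "l = \<alpha> * test_lo \<epsilon>" and "h = \<alpha> * test_hi \<epsilon> \<eta>"
  have lh: "0 < l" "l < h" using lo_hi_bounds \<alpha> by (auto simp: l_def h_def)
  have L: "L = l / (1 + l)" and H: "H = h / (1 + h)"
    by (simp_all add: L_def H_def test_L_def test_H_def l_def h_def \<alpha>_def)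
  show L0: "0 < L" and H1: "H < 1" using lh by (auto simp: L H)
  have LH: "L < H" using lh by (simp add: L H field_simps)
  have T: "T = (H + L) / 2" by (simp add: T_def test_T_def H_def L_def)
  show "L < T" "T < H" using LH by (auto simp: T)
  show "T - L = (H - L) / 2" "H - T = (H - L) / 2" by (auto simp: T field_simps)
  have pos: "test_n \<epsilon> \<eta> \<delta> * H / (H - L)\<^sup>2 > 0"
    using test_n_pos L0 LH by (intro divide_pos_pos mult_pos_pos) auto
  have N: "N = nat \<lceil>test_n \<epsilon> \<eta> \<delta> * H / (H - L)\<^sup>2\<rceil>"
    by (simp add: N_def test_N_def H_def L_def)
  show "N > 0" using pos by (simp add: N)
  show "test_n \<epsilon> \<eta> \<delta> * H / (H - L)\<^sup>2 \<le> real N" unfolding N by linarith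
  show "real N \<le> test_n \<epsilon> \<eta> \<delta> * H / (H - L)\<^sup>2 + 1" unfolding N using pos by linarith
qed

text \<open>Both follow from \<open>H - L = \<alpha> * (hi - lo) / ((1 + \<alpha> * hi) * (1 +
  \<alpha> * lo))\<close>. The first bounds the number of samples from above, the second the
  binomial variance from below.\<close>

lemma threshold_ratio:
  fixes wt :: weight
  assumes wt: "0 < wt \<sigma>1" "0 < wt \<sigma>2"
  defines "\<alpha> \<equiv> wt \<sigma>1 / wt \<sigma>2" and "L \<equiv> test_L wt \<epsilon> \<sigma>1 \<sigma>2" and "H \<equiv> test_H wt \<epsilon> \<eta> \<sigma>1 \<sigma>2"
    and "lo \<equiv> test_lo \<epsilon>" and "hi \<equiv> test_hi \<epsilon> \<eta>"
  shows "H / (H - L)\<^sup>2 = hi * (1 + \<alpha> * hi) * (1 + \<alpha> * lo)\<^sup>2 / (\<alpha> * (hi - lo)\<^sup>2)"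
    and "H * (1 - H) * (H / (H - L)\<^sup>2) = (hi / (hi - lo))\<^sup>2 * ((1 + \<alpha> * lo)\<^sup>2 / (1 + \<alpha> * hi))"
proof -
  have \<alpha>: "\<alpha> > 0" using wt by (simp add: \<alpha>_def)
  have lh: "0 < lo" "lo < hi" using lo_hi_bounds by (auto simp: lo_def hi_def)
  define l h where "l = 1 + \<alpha> * lo" and "h = 1 + \<alpha> * hi"
  have lh': "l > 0" "h > 0" using \<alpha> lh by (auto simp: l_def h_def add_pos_pos)
  have L: "L = \<alpha> * lo / l" and H: "H = \<alpha> * hi / h"
    by (simp_all add: L_def H_def test_L_def test_H_def l_def h_def lo_def hi_def \<alpha>_def)
  have H1: "1 - H = 1 / h" using lh' unfolding H by (simp add: field_simps) (simp add: h_def)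
  have HL: "H - L = \<alpha> * (hi - lo) / (h * l)"
    unfolding H L using lh' by (simp add: field_simps) (simp add: h_def l_def algebra_simps)
  have d: "hi - lo > 0" using lh by simp
  define d' where "d' = hi - lo"
  have d': "d' > 0" using d by (simp add: d'_def)
  show "H / (H - L)\<^sup>2 = hi * (1 + \<alpha> * hi) * (1 + \<alpha> * lo)\<^sup>2 / (\<alpha> * (hi - lo)\<^sup>2)"
    unfolding HL unfolding H d'_def[symmetric] l_def[symmetric] h_def[symmetric] using \<alpha> lh' d'
    by (simp add: field_simps power2_eq_square)
  show "H * (1 - H) * (H / (H - L)\<^sup>2) = (hi / (hi - lo))\<^sup>2 * ((1 + \<alpha> * lo)\<^sup>2 / (1 + \<alpha> * hi))"
    unfolding HL H1 unfolding H d'_def[symmetric] l_def[symmetric] h_def[symmetric] using \<alpha> lh' d'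
    by (simp add: field_simps power2_eq_square)
qed

section \<open>Upper bounds for the sample numbers\<close>

lemma test_n_upper:
  "test_n \<epsilon> \<eta> \<delta> \<le> 72 * (1 + ln (1 / \<delta>)) * (1 + ln (1 + 1 / x))"
proof -
  let ?a = "ln (1 / \<delta>)" and ?l = "ln (1 + 1 / x)"
  have a: "?a > 0" using delta by (simp add: ln_div)
  have l: "?l \<ge> 0" using x_pos by simp
  have "ln (real t) \<le> ln (10 * (1 + ?a) / x)"
    using num_iterations_upper num_iterations_pos by (subst ln_le_cancel_iff) auto
  also have "\<dots> = ln 10 + ln (1 + ?a) + ln (1 / x)"
  proof -
    define b where "b = 1 + ?a"
    have b: "b > 0" using a by (simp add: b_def)
    have "ln (10 * b / y) = ln 10 + ln b + ln (1 / y)" if "y > 0" for y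
      using b that by (simp add: ln_mult ln_div)
    from this[OF x_pos] show ?thesis by (simp only: b_def)
  qed
  also have "\<dots> \<le> 9 + ?a + ?l"
  proof (intro add_mono)
    show "ln 10 \<le> (9 :: real)" using ln_le_minus_one[of 10] by simp
    show "ln (1 + ?a) \<le> ?a" using ln_add_one_self_le_self[of ?a] a by simp
    show "ln (1 / x) \<le> ?l" using x_pos by (subst ln_le_cancel_iff) (auto simp: add_pos_pos)
  qed
  finally have "test_n \<epsilon> \<eta> \<delta> \<le> 8 * (9 + 2 * ?a + ?l)"
    using num_iterations_pos delta by (simp add: test_n_def ln_div)
  also have "\<dots> \<le> 72 * (1 + ?a) * (1 + ?l)"
    using a l mult_nonneg_nonneg[of ?a ?l] by (simp add: algebra_simps)
  finally show ?thesis .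
qed

text \<open>The first part of \<open>threshold_ratio\<close> expands into powers of
  \<open>\<alpha>\<close> from -1 to 2, each at most \<open>R^2\<close>. The coefficients 1, 7, 16,
  12 sum to 36, and \<open>1728 = 48 * 36\<close>; the 10 pays for rounding up.\<close>

lemma test_N_upper:
  fixes wt :: weight
  assumes wt: "0 < wt \<sigma>1" "0 < wt \<sigma>2" and R: "wt \<sigma>1 / wt \<sigma>2 \<le> R" "wt \<sigma>2 / wt \<sigma>1 \<le> R" "1 \<le> R"
  shows "real (test_N wt \<epsilon> \<eta> \<delta> \<sigma>1 \<sigma>2) \<le> (1728 * test_n \<epsilon> \<eta> \<delta> + 10) * (R\<^sup>2 / (\<eta> - 6 * \<epsilon>)\<^sup>2)"
proof -
  define \<alpha> lo hi d where "\<alpha> = wt \<sigma>1 / wt \<sigma>2" and "lo = test_lo \<epsilon>" and "hi = test_hi \<epsilon> \<eta>" and "d = \<eta> - 6 * \<epsilon>"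
  have \<alpha>: "\<alpha> > 0" "\<alpha> \<le> R" "1 / \<alpha> \<le> R" using wt R by (auto simp: \<alpha>_def)
  have d: "d > 0" "d / 4 \<le> hi - lo" using eta lo_hi_bounds by (auto simp: d_def hi_def lo_def)
  have lh: "0 \<le> lo" "lo \<le> 2" "0 \<le> hi" "hi \<le> 3" using lo_hi_bounds by (auto simp: hi_def lo_def)
  let ?H = "test_H wt \<epsilon> \<eta> \<sigma>1 \<sigma>2" and ?L = "test_L wt \<epsilon> \<sigma>1 \<sigma>2"
  have R2: "R \<le> R\<^sup>2" "1 \<le> R\<^sup>2"
    using R(3) by (auto simp: self_le_power one_le_power)
  have \<alpha>2: "\<alpha>\<^sup>2 \<le> R\<^sup>2" using \<alpha> by (intro power_mono) auto
  have "?H / (?H - ?L)\<^sup>2 = hi * (1 + \<alpha> * hi) * (1 + \<alpha> * lo)\<^sup>2 / (\<alpha> * (hi - lo)\<^sup>2)"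
    using threshold_ratio(1)[of wt \<sigma>1 \<sigma>2] wt unfolding \<alpha>_def hi_def lo_def by blast
  also have "\<dots> \<le> 3 * (1 + \<alpha> * 3) * (1 + \<alpha> * 2)\<^sup>2 / (\<alpha> * (d / 4)\<^sup>2)"
    using lh d \<alpha> by (intro frac_le mult_mono power_mono add_mono mult_nonneg_nonneg mult_pos_pos) auto
  also have "\<dots> = 48 * (1 / \<alpha> + 7 + 16 * \<alpha> + 12 * \<alpha>\<^sup>2) / d\<^sup>2"
    using \<alpha> d by (simp add: field_simps power2_eq_square)
  also have "\<dots> \<le> 48 * (36 * R\<^sup>2) / d\<^sup>2"
  proof (intro divide_right_mono mult_left_mono)
    have "1 / \<alpha> + 7 + 16 * \<alpha> + 12 * \<alpha>\<^sup>2 \<le> R\<^sup>2 + 7 * R\<^sup>2 + 16 * R\<^sup>2 + 12 * R\<^sup>2"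
      using order_trans[OF \<alpha>(2) R2(1)] order_trans[OF \<alpha>(3) R2(1)] \<alpha>2 R2(2)
      by (intro add_mono mult_left_mono) auto
    then show "1 / \<alpha> + 7 + 16 * \<alpha> + 12 * \<alpha>\<^sup>2 \<le> 36 * R\<^sup>2" by simp
  qed auto
  finally have ratio: "?H / (?H - ?L)\<^sup>2 \<le> 1728 * (R\<^sup>2 / d\<^sup>2)" by simp
  have "d\<^sup>2 \<le> x" unfolding power2_eq_square d_def using eps eta by (intro mult_right_mono) auto
  then have "d\<^sup>2 \<le> 10 * R\<^sup>2" using eta R2 by linarith
  then have one: "1 \<le> 10 * (R\<^sup>2 / d\<^sup>2)" using d by (simp add: field_simps)
  have "real (test_N wt \<epsilon> \<eta> \<delta> \<sigma>1 \<sigma>2) \<le> test_n \<epsilon> \<eta> \<delta> * (?H / (?H - ?L)\<^sup>2) + 1"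
    using threshold_bounds(9)[of wt \<sigma>1 \<sigma>2] wt by simp
  also have "\<dots> \<le> test_n \<epsilon> \<eta> \<delta> * (1728 * (R\<^sup>2 / d\<^sup>2)) + 10 * (R\<^sup>2 / d\<^sup>2)"
    using ratio one test_n_pos by (intro add_mono mult_left_mono) auto
  finally show ?thesis by (simp add: d_def algebra_simps)
qed

lemma num_iterations_samples_upper:
  assumes "1 \<le> R"
  shows "real t * (2 + (1728 * test_n \<epsilon> \<eta> \<delta> + 10) * (R\<^sup>2 / (\<eta> - 6 * \<epsilon>)\<^sup>2)) \<le>
    1300000 * (R\<^sup>2 / (\<eta> * (\<eta> - 6 * \<epsilon>) ^ 3)) * ((1 + ln (1 / \<delta>)) ^ 2 * (1 + ln (1 + 1 / x)))"
proof -
  define a l d Q where "a = 1 + ln (1 / \<delta>)" and "l = 1 + ln (1 + 1 / x)" and "d = \<eta> - 6 * \<epsilon>" and "Q = R\<^sup>2 / d\<^sup>2"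
  have a: "a \<ge> 1" using delta by (simp add: a_def ln_div)
  have l: "l \<ge> 1" using x_pos by (simp add: l_def)
  have d: "d > 0" using eta by (simp add: d_def)
  have al: "1 \<le> a * l" using mult_mono[of 1 a 1 l] a l by simp
  have "d\<^sup>2 \<le> x" unfolding power2_eq_square d_def using eps eta by (intro mult_right_mono) auto
  moreover have "1 \<le> R\<^sup>2" using assms by (simp add: one_le_power)
  ultimately have "d\<^sup>2 \<le> 10 * R\<^sup>2" using eta by linarith
  then have one: "1 \<le> 10 * Q" using d by (simp add: Q_def field_simps)
  have "2 + (1728 * test_n \<epsilon> \<eta> \<delta> + 10) * Q \<le> (1728 * test_n \<epsilon> \<eta> \<delta> + 30) * Q"
    using one by (simp add: algebra_simps)
  also have "\<dots> \<le> (130000 * (a * l)) * Q"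
  proof (intro mult_right_mono)
    \<comment> \<open>By \<open>test_n_upper\<close> the main coefficient is
      \<open>1728 * 72 = 124416\<close>, leaving room for the 30.\<close>
    show "1728 * test_n \<epsilon> \<eta> \<delta> + 30 \<le> 130000 * (a * l)"
      using test_n_upper al unfolding a_def[symmetric] l_def[symmetric] mult.assoc by linarith
  qed (simp add: Q_def)
  finally have "real t * (2 + (1728 * test_n \<epsilon> \<eta> \<delta> + 10) * Q) \<le> (10 * a / x) * (130000 * (a * l) * Q)"
    using num_iterations_upper a x_pos test_n_pos by (intro mult_mono) (auto simp: a_def Q_def)
  also have "\<dots> = 1300000 * (R\<^sup>2 / (\<eta> * d ^ 3)) * (a\<^sup>2 * l)"
    unfolding Q_def d_def[symmetric] by (simp add: power2_eq_square power3_eq_cube field_simps)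
  finally show ?thesis by (simp only: a_def l_def d_def Q_def)
qed

subsection \<open>Acceptance and rejection\<close>

text \<open>Closeness is applied to the kernel output, where the ideal odds are
  \<open>wt \<sigma>1 / wt \<sigma>2\<close>. Errors \<open>1 + \<epsilon>\<close> above and
  \<open>1 - \<epsilon>\<close> below multiply these by at most \<open>test_lo \<epsilon>\<close>,
  which gives hit probability at most \<open>L\<close>.\<close>

lemma test_round_accepts:
  assumes \<phi>: "S \<subseteq> Supp \<phi>" "weight_function S wt" "is_sampler G" "ideal_sampler S wt A" "fresh_vars V \<phi>"
    and close: "eps_close \<epsilon> S wt G A"
    and \<sigma>: "\<sigma>1 \<in> proj_models \<phi> S" "\<sigma>2 \<in> proj_models \<phi> S"
  shows "1 - \<delta> / real t \<le> pmf (test_round G \<epsilon> \<eta> \<delta> \<phi> S wt V (\<sigma>1, \<sigma>2)) False"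
proof (cases "\<sigma>1 = \<sigma>2")
  case True
  then show ?thesis using delta num_iterations_pos by (simp add: test_round_def)
next
  case False
  have dom: "dom \<sigma>1 = S" "dom \<sigma>2 = S" using dom_proj_models[OF \<phi>(1)] \<sigma> by auto
  have wt: "0 < wt \<sigma>1" "0 < wt \<sigma>2" using \<phi>(2) dom by (auto simp: weight_function_def)
  let ?L = "test_L wt \<epsilon> \<sigma>1 \<sigma>2" and ?H = "test_H wt \<epsilon> \<eta> \<sigma>1 \<sigma>2"
    and ?T = "test_T wt \<epsilon> \<eta> \<sigma>1 \<sigma>2" and ?N = "test_N wt \<epsilon> \<eta> \<delta> \<sigma>1 \<sigma>2"
  note thr = threshold_bounds[OF wt]
  have "pmf (test_round G \<epsilon> \<eta> \<delta> \<phi> S wt V (\<sigma>1, \<sigma>2)) True \<le> \<delta> / real t"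
  proof (rule pmf_test_round_cases(2)[OF False thr(5)])
    fix \<phi>' assume \<phi>': "\<phi>' \<in> set_pmf (barbarik2_kernel V \<phi> \<sigma>1 \<sigma>2)"
    note k = kernel_models[OF \<phi>(1,5) \<sigma> False \<phi>']
    let ?g = "pmf (G \<phi>' S wt)"
    have supp: "set_pmf (G \<phi>' S wt) \<subseteq> {\<sigma>1, \<sigma>2}"
      using \<phi>(2,3) k unfolding is_sampler_def by blast
    have sum1: "?g \<sigma>1 + ?g \<sigma>2 = 1"
      using sum_pmf_eq_1[OF _ supp] False by simp
    have prob: "measure_pmf.prob (G \<phi>' S wt) {\<sigma>. \<sigma> |` S = \<sigma>1} = ?g \<sigma>1"
    proof -
      have "\<sigma>1 |` S = \<sigma>1" "\<sigma>2 |` S = \<sigma>2" using dom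
        by (auto simp: restrict_map_def fun_eq_iff)
      then have "{\<sigma>. \<sigma> |` S = \<sigma>1} \<inter> set_pmf (G \<phi>' S wt) = {\<sigma>1} \<inter> set_pmf (G \<phi>' S wt)"
        using supp False by auto
      then show ?thesis
        by (metis measure_Int_set_pmf measure_pmf_single)
    qed
    have A: "pmf (A \<phi>' S wt) \<sigma> = wt \<sigma> / (wt \<sigma>1 + wt \<sigma>2)" if "\<sigma> \<in> {\<sigma>1, \<sigma>2}" for \<sigma>
      using \<phi>(4) k that False unfolding ideal_sampler_def by simp
    define W where "W = wt \<sigma>1 + wt \<sigma>2"
    have W: "W > 0" using wt by (simp add: W_def)
    have g1: "?g \<sigma>1 \<le> (1 + \<epsilon>) * (wt \<sigma>1 / W)" and g2: "(1 - \<epsilon>) * (wt \<sigma>2 / W) \<le> ?g \<sigma>2"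
      using close k A[of \<sigma>1] A[of \<sigma>2] unfolding eps_close_def W_def by auto
    define l where "l = wt \<sigma>1 / wt \<sigma>2 * test_lo \<epsilon>"
    have l: "l > 0" using wt lo_hi_bounds by (simp add: l_def)
    have "l * ((1 - \<epsilon>) * (wt \<sigma>2 / W)) = (1 + \<epsilon>) * (wt \<sigma>1 / W)"
      using wt eps by (simp add: l_def test_lo_def)
    then have "?g \<sigma>1 \<le> l * ((1 - \<epsilon>) * (wt \<sigma>2 / W))"
      using g1 by (simp only:)
    also have "\<dots> \<le> l * (1 - ?g \<sigma>1)"
      using g2 sum1 l by (intro mult_left_mono) auto
    finally have le_L: "?g \<sigma>1 \<le> ?L"
      using l unfolding test_L_def l_def[symmetric] by (simp add: field_simps)
    have "measure_pmf.prob (binomial_pmf ?N (?g \<sigma>1)) {k. real k > real ?N * ?T}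
        \<le> exp (- (real ?N * (?T - ?L)\<^sup>2 / (2 * ?T)))"
      using le_L thr by (intro binomial_upper_tail) auto
    also have "\<dots> \<le> exp (- test_n \<epsilon> \<eta> \<delta> / 8)"
    proof -
      have HL: "?H - ?L > 0" "?T > 0" using thr(1-3) by auto
      have "test_n \<epsilon> \<eta> \<delta> / 8 = test_n \<epsilon> \<eta> \<delta> * ?H / (?H - ?L)\<^sup>2 * ((?H - ?L) / 2)\<^sup>2 / (2 * ?H)"
      proof -
        define d where "d = ?H - ?L"
        have "d > 0" using HL by (simp add: d_def)
        then show ?thesis unfolding d_def[symmetric] using HL thr(3)
          by (simp add: power2_eq_square)
      qed
      \<comment> \<open>The upper tail exponent has \<open>?T\<close> in place of \<open>?H\<close>
        in the denominator, and \<open>?T < ?H\<close> only enlarges it.\<close>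
      also have "\<dots> \<le> real ?N * ((?H - ?L) / 2)\<^sup>2 / (2 * ?T)"
        using thr(3,8) HL by (intro frac_le mult_right_mono) auto
      finally show ?thesis by (simp add: thr(6))
    qed
    also have "\<dots> = \<delta> / real t" by (rule exp_test_n)
    finally show "measure_pmf.prob
      (binomial_pmf ?N (measure_pmf.prob (G \<phi>' S wt) {\<sigma>. \<sigma> |` S = \<sigma>1})) {k. real k > real ?N * ?T} \<le> \<delta> / real t"
      unfolding prob .
  qed
  then show ?thesis by (simp add: pmf_bool_True)
qed

lemma barbarik2_accepts:
  assumes \<phi>: "models \<phi> \<noteq> {}" "S \<subseteq> Supp \<phi>" "weight_function S wt" "is_sampler G" "ideal_sampler S wt A"
      "fresh_vars V \<phi>"
    and close: "eps_close \<epsilon> S wt G A"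
  shows "1 - \<delta> \<le> measure_pmf.prob (barbarik2 G A \<epsilon> \<eta> \<delta> \<phi> S wt V) {(v, c). v = ACCEPT}"
proof -
  let ?Q = "pair_pmf (G \<phi> S wt) (A \<phi> S wt)"
  let ?E = "measure_pmf.expectation ?Q (\<lambda>p. pmf (test_round G \<epsilon> \<eta> \<delta> \<phi> S wt V p) False)"
  have supp: "set_pmf (G \<phi> S wt) \<subseteq> proj_models \<phi> S" "set_pmf (A \<phi> S wt) \<subseteq> proj_models \<phi> S"
    using \<phi> by (auto simp: is_sampler_def ideal_sampler_def)
  have t: "\<delta> / real t \<le> 1" using num_iterations_pos delta by (simp add: divide_le_eq)
  have "1 - \<delta> / real t \<le> ?E"
  proof (intro measure_pmf.integral_ge_const measure_pmf.integrable_const_bound[where B = 1])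
    show "AE p in ?Q. 1 - \<delta> / real t \<le> pmf (test_round G \<epsilon> \<eta> \<delta> \<phi> S wt V p) False"
      using supp test_round_accepts[OF \<phi>(2-6) close] by (auto simp: AE_measure_pmf_iff)
  qed (auto simp: pmf_le_1)
  then have "(1 - \<delta> / real t) ^ t \<le> ?E ^ t"
    using t by (intro power_mono) auto
  \<comment> \<open>Bernoulli's inequality takes the place of a union bound over the
    \<open>t\<close> rounds.\<close>
  moreover have "1 - \<delta> \<le> (1 - \<delta> / real t) ^ t"
    using Bernoulli_inequality[of "- (\<delta> / real t)" t] t num_iterations_pos by simp
  ultimately show ?thesis unfolding prob_barbarik2_ACCEPT by linarith
qed

text \<open>Subquery consistency makes the hit probability at least the conditional share of
  \<open>\<sigma>1\<close>, which \<open>bad\<close> bounds below by \<open>H\<close>. As upper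
  tails grow with the success probability, a bound at \<open>H\<close> suffices.\<close>

lemma bad_pair_rejected:
  assumes \<phi>: "S \<subseteq> Supp \<phi>" "weight_function S wt"
    and cons: "subquery_consistent V wt \<phi> G"
    and \<sigma>: "\<sigma>1 \<in> proj_models \<phi> S" "\<sigma>2 \<in> proj_models \<phi> S" "\<sigma>1 \<noteq> \<sigma>2"
    and pos: "0 < pmf (G \<phi> S wt) \<sigma>1"
    and bad: "test_hi \<epsilon> \<eta> * pmf (G \<phi> S wt) \<sigma>2 * wt \<sigma>1 \<le> pmf (G \<phi> S wt) \<sigma>1 * wt \<sigma>2"
    and b: "b \<le> measure_pmf.prob (binomial_pmf (test_N wt \<epsilon> \<eta> \<delta> \<sigma>1 \<sigma>2) (test_H wt \<epsilon> \<eta> \<sigma>1 \<sigma>2))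
        {k. real k > real (test_N wt \<epsilon> \<eta> \<delta> \<sigma>1 \<sigma>2) * test_T wt \<epsilon> \<eta> \<sigma>1 \<sigma>2}"
  shows "b \<le> pmf (test_round G \<epsilon> \<eta> \<delta> \<phi> S wt V (\<sigma>1, \<sigma>2)) True"
proof -
  have dom: "dom \<sigma>1 = S" "dom \<sigma>2 = S" using dom_proj_models[OF \<phi>(1)] \<sigma> by auto
  have wt: "0 < wt \<sigma>1" "0 < wt \<sigma>2" using \<phi>(2) dom by (auto simp: weight_function_def)
  note thr = threshold_bounds[OF wt]
  let ?g = "pmf (G \<phi> S wt)" and ?H = "test_H wt \<epsilon> \<eta> \<sigma>1 \<sigma>2"
  show ?thesis
  proof (rule pmf_test_round_cases(1)[OF \<sigma>(3) thr(5)])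
    fix \<phi>' assume \<phi>': "\<phi>' \<in> set_pmf (barbarik2_kernel V \<phi> \<sigma>1 \<sigma>2)"
    have ne: "set_pmf (G \<phi> S wt) \<inter> {\<sigma>1, \<sigma>2} \<noteq> {}"
      using pos by (auto simp: set_pmf_iff)
    have G': "G \<phi>' S wt = cond_pmf (G \<phi> S wt) {\<sigma>1, \<sigma>2}"
      using cons \<phi> \<sigma> ne \<phi>' unfolding subquery_consistent_def by blast
    have "?H \<le> ?g \<sigma>1 / (?g \<sigma>1 + ?g \<sigma>2)"
    proof -
      define h where "h = wt \<sigma>1 / wt \<sigma>2 * test_hi \<epsilon> \<eta>"
      have h: "h > 0" using wt lo_hi_bounds by (simp add: h_def)
      have "h * ?g \<sigma>2 \<le> ?g \<sigma>1" using bad wt by (simp add: h_def field_simps)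
      then show ?thesis using h pos pmf_nonneg[of "G \<phi> S wt" \<sigma>2]
        unfolding test_H_def h_def[symmetric] by (simp add: field_simps add_pos_nonneg)
    qed
    also have "\<dots> = pmf (G \<phi>' S wt) \<sigma>1"
      unfolding G' using pmf_cond[OF ne] \<sigma>(3) by (simp add: measure_measure_pmf_finite)
    also have "\<dots> \<le> measure_pmf.prob (G \<phi>' S wt) {\<sigma>. \<sigma> |` S = \<sigma>1}"
    proof -
      have "\<sigma>1 |` S = \<sigma>1" using dom by (auto simp: restrict_map_def fun_eq_iff)
      then show ?thesis
        unfolding measure_pmf_single[symmetric] by (intro measure_pmf.finite_measure_mono) auto
    qed
    finally have "?H \<le> measure_pmf.prob (G \<phi>' S wt) {\<sigma>. \<sigma> |` S = \<sigma>1}" .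
    then show "b \<le> measure_pmf.prob
      (binomial_pmf (test_N wt \<epsilon> \<eta> \<delta> \<sigma>1 \<sigma>2) (measure_pmf.prob (G \<phi>' S wt) {\<sigma>. \<sigma> |` S = \<sigma>1}))
      {k. real k > real (test_N wt \<epsilon> \<eta> \<delta> \<sigma>1 \<sigma>2) * test_T wt \<epsilon> \<eta> \<sigma>1 \<sigma>2}"
      using thr by (intro order_trans[OF b] binomial_upper_tail_mono) auto
  qed
qed

lemma threshold_tail:
  fixes wt :: weight
  assumes wt: "0 < wt \<sigma>1" "0 < wt \<sigma>2"
  shows "1 - \<delta> / real t \<le> measure_pmf.prob
     (binomial_pmf (test_N wt \<epsilon> \<eta> \<delta> \<sigma>1 \<sigma>2) (test_H wt \<epsilon> \<eta> \<sigma>1 \<sigma>2))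
     {k. real k > real (test_N wt \<epsilon> \<eta> \<delta> \<sigma>1 \<sigma>2) * test_T wt \<epsilon> \<eta> \<sigma>1 \<sigma>2}"
proof -
  let ?L = "test_L wt \<epsilon> \<sigma>1 \<sigma>2" and ?H = "test_H wt \<epsilon> \<eta> \<sigma>1 \<sigma>2"
    and ?T = "test_T wt \<epsilon> \<eta> \<sigma>1 \<sigma>2" and ?N = "test_N wt \<epsilon> \<eta> \<delta> \<sigma>1 \<sigma>2"
  note thr = threshold_bounds[OF wt]
  have HL: "?H - ?L > 0" "?H > 0" using thr(1-3) by auto
  have "test_n \<epsilon> \<eta> \<delta> / 8 = test_n \<epsilon> \<eta> \<delta> * ?H / (?H - ?L)\<^sup>2 * ((?H - ?L) / 2)\<^sup>2 / (2 * ?H)"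
  proof -
    define d where "d = ?H - ?L"
    have "d > 0" using HL by (simp add: d_def)
    then show ?thesis unfolding d_def[symmetric] using HL
      by (simp add: power2_eq_square)
  qed
  also have "\<dots> \<le> real ?N * ((?H - ?L) / 2)\<^sup>2 / (2 * ?H)"
    using thr(8) HL by (intro divide_right_mono mult_right_mono) auto
  finally have "exp (- (real ?N * (?H - ?T)\<^sup>2 / (2 * ?H))) \<le> exp (- test_n \<epsilon> \<eta> \<delta> / 8)"
    by (simp add: thr(7))
  then have "1 - \<delta> / real t \<le> 1 - exp (- (real ?N * (?H - ?T)\<^sup>2 / (2 * ?H)))"
    unfolding exp_test_n by simp
  also have "\<dots> \<le> measure_pmf.prob (binomial_pmf ?N ?H) {k. real k > real ?N * ?T}"
    using thr by (intro binomial_lower_tail) auto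
  finally show ?thesis .
qed

text \<open>Instantiates \<open>binomial_tail_single_round\<close> with
  \<open>\<tau> = \<eta> / 2\<close> and \<open>z = 1 - \<delta>\<close>. For \<open>t = 1\<close>
  the sample parameter is \<open>8 * ln (1 / \<delta>)\<close>, hence at least
  \<open>8 * z\<close>.\<close>

lemma threshold_tail_single_round:
  fixes wt :: weight
  assumes wt: "0 < wt \<sigma>1" "0 < wt \<sigma>2" and t: "t = 1" and \<eta>: "\<eta> / 2 \<le> 1"
  shows "1 - \<delta> \<le> \<eta> / 2 * (1 - (1 - \<eta> / 2)\<^sup>2 / 4) * measure_pmf.prob
     (binomial_pmf (test_N wt \<epsilon> \<eta> \<delta> \<sigma>1 \<sigma>2) (test_H wt \<epsilon> \<eta> \<sigma>1 \<sigma>2))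
     {k. real k > real (test_N wt \<epsilon> \<eta> \<delta> \<sigma>1 \<sigma>2) * test_T wt \<epsilon> \<eta> \<sigma>1 \<sigma>2}"
proof (rule binomial_tail_single_round)
  let ?L = "test_L wt \<epsilon> \<sigma>1 \<sigma>2" and ?H = "test_H wt \<epsilon> \<eta> \<sigma>1 \<sigma>2"
    and ?T = "test_T wt \<epsilon> \<eta> \<sigma>1 \<sigma>2" and ?N = "test_N wt \<epsilon> \<eta> \<delta> \<sigma>1 \<sigma>2"
  note thr = threshold_bounds[OF wt]
  have HL: "?H - ?L > 0" "?H > 0" using thr(1-3) by auto
  have n: "test_n \<epsilon> \<eta> \<delta> = 8 * ln (1 / \<delta>)" using t by (simp add: test_n_def)
  have z: "1 - \<delta> \<le> ln (1 / \<delta>)" using ln_le_minus_one[of \<delta>] delta by (simp add: ln_div)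
  show "?H \<in> {0..1}" using thr HL by auto
  show "0 < \<eta> / 2" using eps eta by simp
  show "\<eta> / 2 \<le> 1" by (rule \<eta>)
  show "0 < 1 - \<delta>" using delta by simp
  \<comment> \<open>A single iteration means \<open>1 / \<delta> \<le> 10 / (10 - x)\<close>, that
    is \<open>1 - \<delta> \<le> x / 10\<close>.\<close>
  show "1 - \<delta> \<le> 2 / 5 * (\<eta> / 2)\<^sup>2"
  proof -
    have l: "ln (10 / (10 - x)) > 0" using ln_ratio x_pos by linarith
    have "ln (1 / \<delta>) / ln (10 / (10 - x)) \<le> 1"
      using t unfolding num_iterations_def by linarith
    then have "ln (1 / \<delta>) \<le> ln (10 / (10 - x))" using l by (simp add: divide_le_eq)
    then have "1 / \<delta> \<le> 10 / (10 - x)"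
      using delta eta by (subst (asm) ln_le_cancel_iff) auto
    then have "1 - \<delta> \<le> x / 10" using delta eta by (simp add: field_simps)
    also have "x \<le> \<eta> * \<eta>" using eps eta by (intro mult_left_mono) auto
    finally show ?thesis by (simp add: power2_eq_square)
  qed
  have NHT: "real ?N * ?H - real ?N * ?T = real ?N * ((?H - ?L) / 2)"
    by (simp only: thr(7)[symmetric] right_diff_distrib)
  show "0 \<le> real ?N * ?H - real ?N * ?T"
    unfolding NHT using HL by simp
  have nH: "test_n \<epsilon> \<eta> \<delta> * ?H \<le> real ?N * (?H - ?L)\<^sup>2"
    using thr(8) HL by (simp add: pos_divide_le_eq)
  show "2 * (1 - \<delta>) * (real ?N * ?H * (1 - ?H)) \<le> (real ?N * ?H - real ?N * ?T)\<^sup>2"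
  proof -
    have "(1 - \<delta>) * (1 - ?H) \<le> ln (1 / \<delta>) * 1"
      using z thr(4) HL delta by (intro mult_mono) auto
    then have "2 * (real ?N * ?H) * ((1 - \<delta>) * (1 - ?H)) \<le> 2 * (real ?N * ?H) * (ln (1 / \<delta>) * 1)"
      using HL by (intro mult_left_mono) auto
    then have "2 * (1 - \<delta>) * (real ?N * ?H * (1 - ?H)) \<le> real ?N * (2 * ln (1 / \<delta>) * ?H)"
      by (simp only: mult_ac mult_1_right)
    also have "\<dots> \<le> real ?N * (real ?N * (?H - ?L)\<^sup>2 / 4)"
      using nH unfolding n by (intro mult_left_mono) auto
    also have "\<dots> = (real ?N * ?H - real ?N * ?T)\<^sup>2"
      unfolding NHT by (simp add: power2_eq_square)
    finally show ?thesis .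
  qed
  show "32 * (1 - \<delta>) * ((1 + \<eta> / 2 / 2) / (\<eta> / 2))\<^sup>2 \<le> real ?N * ?H * (1 - ?H)"
  proof -
    define \<alpha> lo hi where "\<alpha> = wt \<sigma>1 / wt \<sigma>2" and "lo = test_lo \<epsilon>" and "hi = test_hi \<epsilon> \<eta>"
    have \<alpha>: "\<alpha> > 0" using wt by (simp add: \<alpha>_def)
    have lh: "1 \<le> lo" "lo < hi" "hi - lo \<le> \<eta> / 4"
      using lo_hi_bounds by (auto simp: lo_def hi_def)
    have hi: "1 + \<eta> / 4 \<le> hi" "hi \<le> 2" using eps eta \<eta> by (auto simp: hi_def test_hi_def)
    have "2 * ((1 + \<eta> / 2 / 2) / (\<eta> / 2)) = (1 + \<eta> / 4) / (\<eta> / 4)"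
      using eps eta by (simp add: field_simps)
    also have "\<dots> \<le> hi / (hi - lo)"
      using lh hi eps eta by (intro frac_le) auto
    finally have ratio: "2 * ((1 + \<eta> / 2 / 2) / (\<eta> / 2)) \<le> hi / (hi - lo)" .
    \<comment> \<open>Bernoulli's inequality for the square, together with
      \<open>hi \<le> 2 \<le> 2 * lo\<close>, makes this factor of the variance harmless uniformly
      in \<open>\<alpha>\<close>.\<close>
    have one: "1 \<le> (1 + \<alpha> * lo)\<^sup>2 / (1 + \<alpha> * hi)"
    proof -
      have "\<alpha> * hi \<le> \<alpha> * (2 * lo)" using \<alpha> hi lh by (intro mult_left_mono) auto
      then have "1 + \<alpha> * hi \<le> 1 + 2 * (\<alpha> * lo)" by simp
      also have "1 + 2 * (\<alpha> * lo) \<le> (1 + \<alpha> * lo)\<^sup>2"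
        using zero_le_power2[of "\<alpha> * lo"] by (simp add: power2_sum)
      finally show ?thesis using \<alpha> lh by (simp add: pos_le_divide_eq add_pos_pos)
    qed
    have "32 * (1 - \<delta>) * ((1 + \<eta> / 2 / 2) / (\<eta> / 2))\<^sup>2 =
        8 * (1 - \<delta>) * (2 * ((1 + \<eta> / 2 / 2) / (\<eta> / 2)))\<^sup>2"
      unfolding power_mult_distrib by simp
    also have "\<dots> \<le> test_n \<epsilon> \<eta> \<delta> * (hi / (hi - lo))\<^sup>2"
      using ratio z n delta eps eta by (intro mult_mono power_mono) auto
    also have "\<dots> \<le> test_n \<epsilon> \<eta> \<delta> * ((hi / (hi - lo))\<^sup>2 * ((1 + \<alpha> * lo)\<^sup>2 / (1 + \<alpha> * hi)))"
      using one test_n_pos mult_left_mono[OF one, of "(hi / (hi - lo))\<^sup>2"] by (intro mult_left_mono) auto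
    also have "\<dots> = test_n \<epsilon> \<eta> \<delta> * ?H / (?H - ?L)\<^sup>2 * (?H * (1 - ?H))"
      unfolding \<alpha>_def lo_def hi_def threshold_ratio(2)[OF wt, symmetric] by simp
    also have "\<dots> \<le> real ?N * (?H * (1 - ?H))"
      using thr(4,8) HL by (intro mult_right_mono) auto
    finally show ?thesis by (simp add: mult.assoc)
  qed
qed

lemma barbarik2_rejects:
  assumes \<phi>: "models \<phi> \<noteq> {}" "S \<subseteq> Supp \<phi>" "weight_function S wt" "is_sampler G" "ideal_sampler S wt A"
    and cons: "subquery_consistent V wt \<phi> G" and far: "eta_far \<eta> \<phi> S wt G A"
  shows "1 - \<delta> \<le> measure_pmf.prob (barbarik2 G A \<epsilon> \<eta> \<delta> \<phi> S wt V) {(v, c). v = REJECT}"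
proof -
  define P where "P = proj_models \<phi> S"
  define a g where "a = pmf (A \<phi> S wt)" and "g = pmf (G \<phi> S wt)"
  define \<tau> where "\<tau> = \<eta> / 2"
  define h where "h = test_hi \<epsilon> \<eta> - 1"
  define B where "B = \<tau> * (1 - (1 - \<tau>)\<^sup>2 / 4)"
  let ?Q = "pair_pmf (G \<phi> S wt) (A \<phi> S wt)"
  let ?round = "\<lambda>p. test_round G \<epsilon> \<eta> \<delta> \<phi> S wt V p"
  have finP: "finite P" unfolding P_def by (rule finite_proj_models)
  have supp: "set_pmf (G \<phi> S wt) \<subseteq> P" "set_pmf (A \<phi> S wt) \<subseteq> P"
    using \<phi> by (auto simp: P_def is_sampler_def ideal_sampler_def)
  have wt: "0 < wt \<sigma>" if "\<sigma> \<in> P" for \<sigma>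
    using dom_proj_models[OF \<phi>(2)] that \<phi>(3) by (auto simp: weight_function_def P_def)
  define Z where "Z = sum wt P"
  have "P \<noteq> {}" using \<phi>(1) by (simp add: P_def proj_models_def)
  then have Z: "Z > 0" unfolding Z_def using finP wt by (intro sum_pos) auto
  have a: "a \<sigma> = wt \<sigma> / Z" if "\<sigma> \<in> P" for \<sigma>
    using \<phi>(2,5) that by (simp add: ideal_sampler_def a_def P_def Z_def)
  have a_pos: "0 < a \<sigma>" if "\<sigma> \<in> P" for \<sigma> using a wt Z that by simp
  have h: "0 \<le> h" "h \<le> \<tau>" using eps eta by (auto simp: h_def test_hi_def \<tau>_def)
  have far': "2 * \<tau> \<le> (\<Sum>x\<in>P. \<bar>a x - g x\<bar>)"
    using far by (simp add: eta_far_def P_def a_def g_def \<tau>_def)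
  have sums: "sum a P = 1" "sum g P = 1"
    using finP supp by (auto simp: a_def g_def intro!: sum_pmf_eq_1)
  let ?X = "{x\<in>P. a x < g x}"
  let ?Y = "\<lambda>x. {y\<in>P. (1 + h) * g y * a x \<le> g x * a y}"
  have \<tau>1: "\<tau> \<le> 1" and B: "B \<le> (\<Sum>x\<in>?X. \<Sum>y\<in>?Y x. g x * a y)"
    using bad_pair_probability[OF finP a_pos _ sums far' h] unfolding B_def by (simp_all add: g_def)
  have \<tau>0: "\<tau> > 0" using eps eta by (simp add: \<tau>_def)
  have B0: "B > 0"
  proof -
    have "(1 - \<tau>)\<^sup>2 \<le> 1" using \<tau>0 \<tau>1 by (intro power_le_one) auto
    then show ?thesis using \<tau>0 by (simp add: B_def)
  qed
  \<comment> \<open>A bad pair has probability at least \<open>B\<close> and is rejected with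
    probability at least \<open>b\<close>; the value of \<open>b\<close> depends on whether
    \<open>t = 1\<close>.\<close>
  have accept_le: "measure_pmf.expectation ?Q (\<lambda>p. pmf (?round p) False) \<le> 1 - B * b"
    if b0: "0 \<le> b" and b: "\<And>\<sigma>1 \<sigma>2. \<sigma>1 \<in> P \<Longrightarrow> \<sigma>2 \<in> P \<Longrightarrow>
        b \<le> measure_pmf.prob (binomial_pmf (test_N wt \<epsilon> \<eta> \<delta> \<sigma>1 \<sigma>2) (test_H wt \<epsilon> \<eta> \<sigma>1 \<sigma>2))
        {k. real k > real (test_N wt \<epsilon> \<eta> \<delta> \<sigma>1 \<sigma>2) * test_T wt \<epsilon> \<eta> \<sigma>1 \<sigma>2}" for b
  proof -
    have bad: "b \<le> pmf (?round (\<sigma>1, \<sigma>2)) True" if 1: "\<sigma>1 \<in> ?X" and 2: "\<sigma>2 \<in> ?Y \<sigma>1" for \<sigma>1 \<sigma>2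
    proof (rule bad_pair_rejected[OF \<phi>(2,3) cons])
      have P: "\<sigma>1 \<in> P" "\<sigma>2 \<in> P" using 1 2 by auto
      then show "\<sigma>1 \<in> proj_models \<phi> S" "\<sigma>2 \<in> proj_models \<phi> S" by (auto simp: P_def)
      have g1: "0 < g \<sigma>1" using 1 a_pos[OF P(1)] by simp
      then show "0 < pmf (G \<phi> S wt) \<sigma>1" by (simp add: g_def)
      have hi: "1 + h = test_hi \<epsilon> \<eta>" by (simp add: h_def)
      show "\<sigma>1 \<noteq> \<sigma>2"
      proof
        assume eq: "\<sigma>1 = \<sigma>2"
        then have "(1 + h) * (g \<sigma>1 * a \<sigma>1) \<le> 1 * (g \<sigma>1 * a \<sigma>1)"
          using 2 by (simp add: mult_ac)
        then have "1 + h \<le> 1" using g1 a_pos[OF P(1)] by (subst (asm) mult_le_cancel_right_pos) auto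
        then show False using lo_hi_bounds by (simp add: hi)
      qed
      have "(test_hi \<epsilon> \<eta> * g \<sigma>2 * wt \<sigma>1) / Z \<le> (g \<sigma>1 * wt \<sigma>2) / Z"
        using 2 unfolding hi a[OF P(1)] a[OF P(2)] by (simp add: a[OF P(2)])
      then show "test_hi \<epsilon> \<eta> * pmf (G \<phi> S wt) \<sigma>2 * wt \<sigma>1 \<le> pmf (G \<phi> S wt) \<sigma>1 * wt \<sigma>2"
        using Z by (simp add: g_def divide_le_cancel)
    qed (rule b, use 1 2 in auto)
    have "B * b \<le> (\<Sum>x\<in>?X. \<Sum>y\<in>?Y x. g x * a y) * b"
      using B b0 by (rule mult_right_mono)
    also have "\<dots> = (\<Sum>x\<in>?X. \<Sum>y\<in>?Y x. g x * a y * b)"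
      by (simp add: sum_distrib_right)
    also have "\<dots> \<le> (\<Sum>x\<in>?X. \<Sum>y\<in>?Y x. g x * a y * pmf (?round (x, y)) True)"
      using bad by (intro sum_mono mult_left_mono) (auto simp: a_def g_def)
    also have "\<dots> \<le> (\<Sum>x\<in>P. \<Sum>y\<in>P. g x * a y * pmf (?round (x, y)) True)"
      using finP by (intro order_trans[OF sum_mono[OF sum_mono2] sum_mono2] sum_nonneg)
        (auto simp: a_def g_def)
    also have "\<dots> = measure_pmf.expectation ?Q (\<lambda>p. pmf (?round p) True)"
    proof -
      have "measure_pmf.expectation ?Q (\<lambda>p. pmf (?round p) True) =
          (\<Sum>p\<in>P \<times> P. pmf (?round p) True * pmf ?Q p)"
        using finP supp by (intro integral_measure_pmf_real) auto
      then show ?thesis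
        by (auto simp: sum.cartesian_product pmf_pair a_def g_def mult_ac intro!: sum.cong)
    qed
    also have "\<dots> = measure_pmf.expectation ?Q (\<lambda>p. 1 - pmf (?round p) False)"
      by (simp add: pmf_bool_True)
    also have "\<dots> = 1 - measure_pmf.expectation ?Q (\<lambda>p. pmf (?round p) False)"
      by (subst Bochner_Integration.integral_diff)
        (auto intro!: measure_pmf.integrable_const_bound[where B = 1] simp: pmf_le_1)
    finally show ?thesis by simp
  qed
  have E0: "0 \<le> measure_pmf.expectation ?Q (\<lambda>p. pmf (?round p) False)" by (intro Bochner_Integration.integral_nonneg) simp
  have "measure_pmf.expectation ?Q (\<lambda>p. pmf (?round p) False) ^ t \<le> \<delta>"
  proof (cases "t = 1")
    case True
    \<comment> \<open>With this \<open>b\<close> the factor \<open>B\<close> cancels, leaving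
      acceptance probability at most \<open>\<delta>\<close> in the only round.\<close>
    have "measure_pmf.expectation ?Q (\<lambda>p. pmf (?round p) False) \<le> 1 - B * ((1 - \<delta>) / B)"
    proof (rule accept_le)
      show "0 \<le> (1 - \<delta>) / B" using B0 delta by simp
      fix \<sigma>1 \<sigma>2 assume "\<sigma>1 \<in> P" "\<sigma>2 \<in> P"
      then show "(1 - \<delta>) / B \<le> measure_pmf.prob
          (binomial_pmf (test_N wt \<epsilon> \<eta> \<delta> \<sigma>1 \<sigma>2) (test_H wt \<epsilon> \<eta> \<sigma>1 \<sigma>2))
          {k. real k > real (test_N wt \<epsilon> \<eta> \<delta> \<sigma>1 \<sigma>2) * test_T wt \<epsilon> \<eta> \<sigma>1 \<sigma>2}"
        using threshold_tail_single_round[of wt \<sigma>1 \<sigma>2] wt True \<tau>1 B0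
        unfolding \<tau>_def[symmetric] B_def[symmetric] by (simp add: pos_divide_le_eq mult.commute)
    qed
    then show ?thesis using B0 True by simp
  next
    case False
    then have t2: "2 \<le> real t" using num_iterations_pos by simp
    have half: "1 / 2 \<le> 1 - \<delta> / real t"
    proof -
      have "\<delta> / real t \<le> 1 / 2" using t2 delta by (intro frac_le) auto
      then show ?thesis by simp
    qed
    have "measure_pmf.expectation ?Q (\<lambda>p. pmf (?round p) False) \<le> 1 - B * (1 - \<delta> / real t)"
    proof (rule accept_le)
      show "0 \<le> 1 - \<delta> / real t" by (rule order_trans[OF _ half]) simp
    qed (intro threshold_tail wt)
    also have "\<dots> \<le> 1 - B * (1 / 2)"
      using half B0 by (intro diff_left_mono mult_left_mono) auto
    \<comment> \<open>This is \<open>B / 2 \<ge> x / 10\<close>: use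
      \<open>x \<le> 4 * \<tau>^2\<close> and divide by \<open>\<tau>\<close>.\<close>
    also have "\<dots> \<le> 1 - x / 10"
    proof -
      have "x \<le> \<eta> * \<eta>" using eps eta by (intro mult_left_mono) auto
      also have "\<dots> = 4 * \<tau>\<^sup>2" by (simp add: \<tau>_def power2_eq_square)
      finally have "x / 10 \<le> \<tau> * (4 / 10 * \<tau>)" by (simp add: power2_eq_square)
      also have "\<dots> \<le> \<tau> * ((1 - (1 - \<tau>)\<^sup>2 / 4) * (1 / 2))"
      proof (rule mult_left_mono)
        have "\<tau>\<^sup>2 \<le> \<tau>" using \<tau>0 \<tau>1 power_decreasing[of 1 2 \<tau>] by simp
        then show "4 / 10 * \<tau> \<le> (1 - (1 - \<tau>)\<^sup>2 / 4) * (1 / 2)"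
          using \<tau>1 by (simp add: power2_diff field_simps)
      qed (use \<tau>0 in simp)
      finally show ?thesis by (simp add: B_def mult_ac)
    qed
    finally show ?thesis using E0 by (intro power_num_iterations)
  qed
  then show ?thesis
    unfolding prob_barbarik2_REJECT prob_barbarik2_ACCEPT by simp
qed

end

subsection \<open>The number of samples\<close>

lemma tilt_bounds:
  assumes "\<sigma>1 \<in> proj_models \<phi> S" "\<sigma>2 \<in> proj_models \<phi> S"
  shows "wt \<sigma>1 / wt \<sigma>2 \<le> tilt wt \<phi> S"
proof -
  have "{wt \<sigma>1 / wt \<sigma>2 |\<sigma>1 \<sigma>2. \<sigma>1 \<in> proj_models \<phi> S \<and> \<sigma>2 \<in> proj_models \<phi> S} =
      (\<lambda>(\<sigma>1, \<sigma>2). wt \<sigma>1 / wt \<sigma>2) ` (proj_models \<phi> S \<times> proj_models \<phi> S)"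
    by auto
  then have "finite {wt \<sigma>1 / wt \<sigma>2 |\<sigma>1 \<sigma>2. \<sigma>1 \<in> proj_models \<phi> S \<and> \<sigma>2 \<in> proj_models \<phi> S}"
    by (simp add: finite_proj_models)
  then show ?thesis
    unfolding tilt_def using assms by (intro Max_ge) auto
qed

context barbarik_params
begin

lemma barbarik2_num_samples:
  assumes \<phi>: "models \<phi> \<noteq> {}" "S \<subseteq> Supp \<phi>" "weight_function S wt" "is_sampler G" "ideal_sampler S wt A"
    and mem: "(v, c) \<in> set_pmf (barbarik2 G A \<epsilon> \<eta> \<delta> \<phi> S wt V)"
  shows "real c \<le> 1300000 * ((tilt wt \<phi> S)\<^sup>2 / (\<eta> * (\<eta> - 6 * \<epsilon>) ^ 3)) *
      ((1 + ln (1 / \<delta>)) ^ 2 * (1 + ln (1 + 1 / x)))"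
proof -
  let ?R = "tilt wt \<phi> S"
  have supp: "set_pmf (G \<phi> S wt) \<subseteq> proj_models \<phi> S" "set_pmf (A \<phi> S wt) \<subseteq> proj_models \<phi> S"
    using \<phi> by (auto simp: is_sampler_def ideal_sampler_def)
  have wt: "0 < wt \<sigma>" if "\<sigma> \<in> proj_models \<phi> S" for \<sigma>
    using dom_proj_models[OF \<phi>(2) that] \<phi>(3) by (auto simp: weight_function_def)
  obtain \<sigma> where "\<sigma> \<in> proj_models \<phi> S" using \<phi>(1) by (auto simp: proj_models_def)
  \<comment> \<open>The pair of \<open>\<sigma>\<close> with itself has ratio 1. As the tilt ranges
    over ordered pairs, it bounds a ratio and its inverse alike.\<close>
  then have R: "1 \<le> ?R" using tilt_bounds[of \<sigma> \<phi> S \<sigma> wt] wt[of \<sigma>] by simp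
  have "real c \<le> real t * (2 + (1728 * test_n \<epsilon> \<eta> \<delta> + 10) * (?R\<^sup>2 / (\<eta> - 6 * \<epsilon>)\<^sup>2))"
  proof (rule barbarik2_samples[OF mem])
    fix \<sigma>1 \<sigma>2 assume "\<sigma>1 \<in> set_pmf (G \<phi> S wt)" "\<sigma>2 \<in> set_pmf (A \<phi> S wt)"
    then have "\<sigma>1 \<in> proj_models \<phi> S" "\<sigma>2 \<in> proj_models \<phi> S" using supp by auto
    then show "real (test_N wt \<epsilon> \<eta> \<delta> \<sigma>1 \<sigma>2) \<le>
        (1728 * test_n \<epsilon> \<eta> \<delta> + 10) * (?R\<^sup>2 / (\<eta> - 6 * \<epsilon>)\<^sup>2)"
      using R by (intro test_N_upper wt tilt_bounds)
  qed (use test_n_pos in simp)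
  then show ?thesis using num_iterations_samples_upper[OF R] by linarith
qed

end

theorem theorem1:
  shows "\<exists>(C::real) (k::nat). C > 0 \<and>
    (\<forall>(\<phi>::formula) (S::nat set) (wt::weight) (G::sampler) (A::sampler)
       (\<epsilon>::real) (\<eta>::real) (\<delta>::real) (V::nat list).
      models \<phi> \<noteq> {} \<longrightarrow> S \<subseteq> Supp \<phi> \<longrightarrow> weight_function S wt \<longrightarrow>
      is_sampler G \<longrightarrow> ideal_sampler S wt A \<longrightarrow> fresh_vars V \<phi> \<longrightarrow>
      0 \<le> \<epsilon> \<longrightarrow> \<epsilon> < 1 / 3 \<longrightarrow> \<eta> > 6 * \<epsilon> \<longrightarrow> \<eta> * (\<eta> - 6 * \<epsilon>) < 10 \<longrightarrow>
      0 < \<delta> \<longrightarrow> \<delta> < 1 \<longrightarrow>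
        (\<forall>(v, c) \<in> set_pmf (barbarik2 G A \<epsilon> \<eta> \<delta> \<phi> S wt V).
           real c \<le> C * ((tilt wt \<phi> S)\<^sup>2 / (\<eta> * (\<eta> - 6 * \<epsilon>) ^ 3)) *
                     ((1 + ln (1 / \<delta>)) ^ k * (1 + ln (1 + 1 / (\<eta> * (\<eta> - 6 * \<epsilon>))))) \<and>
           (\<delta> \<le> \<eta> * (\<eta> - 6 * \<epsilon>) \<longrightarrow>
             real c \<le> C * ((tilt wt \<phi> S)\<^sup>2 / (\<eta> * (\<eta> - 6 * \<epsilon>) ^ 3)) * (1 + ln (1 / \<delta>)) ^ k)) \<and>
        (eps_close \<epsilon> S wt G A \<longrightarrow>
           measure_pmf.prob (barbarik2 G A \<epsilon> \<eta> \<delta> \<phi> S wt V) {(v, c). v = ACCEPT} \<ge> 1 - \<delta>) \<and>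
        (subquery_consistent V wt \<phi> G \<and> eta_far \<eta> \<phi> S wt G A \<longrightarrow>
           measure_pmf.prob (barbarik2 G A \<epsilon> \<eta> \<delta> \<phi> S wt V) {(v, c). v = REJECT} \<ge> 1 - \<delta>))"
proof -
  \<comment> \<open>For \<open>\<delta> \<le> \<eta> * (\<eta> - 6 * \<epsilon>)\<close> the
    logarithmic factor in \<open>1 / x\<close> is at most \<open>2 * a\<close>. Absorbing it doubles
    the constant 1300000 and raises the exponent from 2 to 3.\<close>
  have samples: "real c \<le> 2600000 * ((tilt wt \<phi> S)\<^sup>2 / (\<eta> * (\<eta> - 6 * \<epsilon>) ^ 3)) *
        ((1 + ln (1 / \<delta>)) ^ 3 * (1 + ln (1 + 1 / (\<eta> * (\<eta> - 6 * \<epsilon>)))))"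
      "\<delta> \<le> \<eta> * (\<eta> - 6 * \<epsilon>) \<Longrightarrow>
        real c \<le> 2600000 * ((tilt wt \<phi> S)\<^sup>2 / (\<eta> * (\<eta> - 6 * \<epsilon>) ^ 3)) * (1 + ln (1 / \<delta>)) ^ 3"
    if \<phi>: "models \<phi> \<noteq> {}" "S \<subseteq> Supp \<phi>" "weight_function S wt" "is_sampler G" "ideal_sampler S wt A"
      and par: "barbarik_params \<epsilon> \<eta> \<delta>"
      and mem: "(v, c) \<in> set_pmf (barbarik2 G A \<epsilon> \<eta> \<delta> \<phi> S wt V)"
    for \<phi> S wt G A \<epsilon> \<eta> \<delta> V v c
  proof -
    interpret barbarik_params \<epsilon> \<eta> \<delta> by (rule par)
    define Q a l where "Q = (tilt wt \<phi> S)\<^sup>2 / (\<eta> * (\<eta> - 6 * \<epsilon>) ^ 3)"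
      and "a = 1 + ln (1 / \<delta>)" and "l = 1 + ln (1 + 1 / x)"
    have c: "real c \<le> 1300000 * Q * (a\<^sup>2 * l)"
      using barbarik2_num_samples[OF \<phi> mem] by (simp only: Q_def a_def l_def)
    have Q: "0 \<le> Q" using eps eta by (simp add: Q_def)
    have a: "1 \<le> a" using delta by (simp add: a_def ln_div)
    have l: "1 \<le> l" using x_pos by (simp add: l_def)
    have "1300000 * Q * (a\<^sup>2 * l) \<le> 2600000 * Q * (a ^ 3 * l)"
      using Q a l by (intro mult_mono power_increasing) auto
    with c show "real c \<le> 2600000 * Q * (a ^ 3 * l)" by linarith
    assume "\<delta> \<le> x"
    then have "1 / x \<le> 1 / \<delta>" using delta by (intro frac_le) auto
    moreover have "1 \<le> 1 / \<delta>" using delta by simp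
    ultimately have "1 + 1 / x \<le> 1 / \<delta> + 1 / \<delta>" by (intro add_mono)
    then have "1 + 1 / x \<le> 2 / \<delta>" by simp
    then have "ln (1 + 1 / x) \<le> ln (2 / \<delta>)"
      using x_pos delta by (subst ln_le_cancel_iff) (auto simp: add_pos_pos)
    also have "\<dots> \<le> a"
      using delta ln_le_minus_one[of 2] by (simp add: a_def ln_div)
    finally have "l \<le> 2 * a" using a by (simp add: l_def)
    then have "1300000 * Q * (a\<^sup>2 * l) \<le> 1300000 * Q * (a\<^sup>2 * (2 * a))"
      using Q by (intro mult_left_mono) auto
    also have "\<dots> = 2600000 * Q * a ^ 3"
      by (simp add: power2_eq_square power3_eq_cube)
    finally show "real c \<le> 2600000 * Q * a ^ 3" using c by linarith
  qed
  show ?thesis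
  proof (rule exI[of _ 2600000], rule exI[of _ 3], intro conjI allI impI ballI, goal_cases)
    case (2 \<phi> S wt G A \<epsilon> \<eta> \<delta> V p)
    have "barbarik_params \<epsilon> \<eta> \<delta>" using 2(7-12) by (rule barbarik_params.intro)
    with 2(13) show ?case
      using samples[OF 2(1-5)] by (cases p) (simp only: prod.case, blast)
  next
    case (3 \<phi> S wt G A \<epsilon> \<eta> \<delta> V)
    have "barbarik_params \<epsilon> \<eta> \<delta>" using 3(7-12) by (rule barbarik_params.intro)
    then show ?case using 3 by (intro barbarik_params.barbarik2_accepts)
  next
    case (4 \<phi> S wt G A \<epsilon> \<eta> \<delta> V)
    have "barbarik_params \<epsilon> \<eta> \<delta>" using 4(7-12) by (rule barbarik_params.intro)
    then show ?case using 4 by (intro barbarik_params.barbarik2_rejects) blast+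
  qed simp
qed

end
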